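(* Let $\phi:\mathbb{R}\to\mathbb{C}$ be defined by $\phi(t)=\sum_{k\in\mathbb{Z}}\frac{e^{-4\pi^2 i k^2 t}-1}{-4\pi^2k^2}$, where the term $k=0$ is understood as its limiting value $it$. For $\sigma\ge 0$ let $D_\sigma=\{x\in\mathbb{R} : \alpha_\phi(x)=\sigma\}$. Then for every $\alpha\in[1/2,3/4]$, \[\dim_{\mathcal H}\phi(D_\alpha)\le \dim_{\mathcal H}\phi\Big(\bigcup_{\sigma\le\alpha}D_\sigma\Big)\le \frac{4\alpha-2}{\alpha}.\]
   Context: For $\beta\ge0$ and $x_0\in\mathbb{R}$, a function $f:\mathbb{R}\to\mathbb{C}$ is in $C^\beta(x_0)$ if there exist a polynomial $P$ (complex coefficients) with $\deg P\le\beta$ and a constant $C>0$ such that $|f(x_0+h)-P(h)|\le C|h|^\beta$ for all sufficiently small $|h|$. The Hölder exponent of $f$ at $x_0$ is $\alpha_f(x_0)=\sup\{\beta\ge0 : f\in C^\beta(x_0)\}$. $\dim_{\mathcal H}$ denotes Hausdorff dimension in $\mathbb{C}\cong\mathbb{R}^2$. *)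

theory Defs
  imports "HOL-Analysis.Analysis" "HOL-Computational_Algebra.Polynomial"
begin

(* |h|^beta with the convention |0|^0 = 1 (Isabelle has 0 powr 0 = 0) *)
definition abs_pow :: "real \<Rightarrow> real \<Rightarrow> real" where
  "abs_pow h b = (if b = 0 then 1 else \<bar>h\<bar> powr b)"

definition pointwise_holder :: "real \<Rightarrow> (real \<Rightarrow> complex) \<Rightarrow> real \<Rightarrow> bool" where
  "pointwise_holder beta f x0 \<longleftrightarrow>
     (\<exists>P :: complex poly. real (degree P) \<le> beta \<and>
        (\<exists>C>0. \<forall>\<^sub>F h in nhds 0.
            norm (f (x0 + h) - poly P (complex_of_real h)) \<le> C * abs_pow h beta))"

definition holder_exponent :: "(real \<Rightarrow> complex) \<Rightarrow> real \<Rightarrow> ereal" where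
  "holder_exponent f x0 = Sup (ereal ` {beta. beta \<ge> 0 \<and> pointwise_holder beta f x0})"

(* the function phi; the k = 0 term is its limiting value i t *)
definition phi_term :: "int \<Rightarrow> real \<Rightarrow> complex" where
  "phi_term k t = (if k = 0 then \<i> * complex_of_real t
     else (exp (- 4 * complex_of_real (pi^2) * \<i> * of_int (k^2) * complex_of_real t) - 1)
          / (- 4 * complex_of_real (pi^2) * of_int (k^2)))"

definition phi :: "real \<Rightarrow> complex" where
  "phi t = (\<Sum>\<^sub>\<infinity>k::int. phi_term k t)"

definition hausdorff_content_term :: "real \<Rightarrow> 'a::metric_space set \<Rightarrow> ennreal" where
  "hausdorff_content_term s U =
     (if U = {} then 0 else if s = 0 then 1 else ennreal (diameter U powr s))"

definition hausdorff_pre :: "real \<Rightarrow> real \<Rightarrow> 'a::metric_space set \<Rightarrow> ennreal" where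
  "hausdorff_pre delta s A =
     (INF U \<in> {U :: nat \<Rightarrow> 'a set. (\<forall>i. bounded (U i) \<and> diameter (U i) \<le> delta)
                                 \<and> A \<subseteq> (\<Union>i. U i)}.
        (\<Sum>i. hausdorff_content_term s (U i)))"

definition hausdorff_measure :: "real \<Rightarrow> 'a::metric_space set \<Rightarrow> ennreal" where
  "hausdorff_measure s A = (SUP delta \<in> {0<..}. hausdorff_pre delta s A)"

definition hausdorff_dim :: "'a::metric_space set \<Rightarrow> ereal" where
  "hausdorff_dim A = Inf (ereal ` {s. s \<ge> 0 \<and> hausdorff_measure s A = 0})"

end

theory Submission
  imports Defs "HOL-Analysis.Kronecker_Approximation_Theorem"
begin

text \<open>
  Up to an affine term, \<open>\<phi>(t)\<close> is \<open>g(x) = \<Sum> e(k\<^sup>2 x) / k\<^sup>2\<close> at \<open>x = -2\<pi>t\<close>, where \<open>e(y) = exp(2\<pi>i y)\<close>, so that its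
  increments are governed by the quadratic Weyl sums \<open>S\<^sub>N(x) = \<Sum>\<^sub>k\<^sub>\<le>\<^sub>N e(k\<^sup>2 x)\<close>: cutting the series at
  \<open>k \<approx> |h|\<^bsup>-1/2\<^esup>\<close>, the low frequencies are estimated through the derivative \<open>2\<pi>i S\<^sub>N\<close> and the high ones by
  partial summation. Since a loss of \<open>N\<^sup>\<epsilon>\<close> is harmless for dimensions and Hoelder exponents, Weyl
  differencing replaces the exact asymptotics of \<open>\<phi>\<close> at the rationals. It yields two estimates.
  If \<open>|h| \<le> q\<^sup>-\<^sup>2\<close>, then \<open>g(p/q + h) - g(p/q)\<close> is of order \<open>q\<^bsup>-1/2\<^esup> |h|\<^bsup>1/2-\<epsilon>\<^esup>\<close>; and if
  \<open>|x - p/q| \<ge> c q\<^sup>-\<^sup>\<mu>\<close> for all \<open>p/q\<close>, with \<open>\<mu> \<ge> 2\<close>, then \<open>g\<close> is \<open>C\<^bsup>1/2+1/(2\<mu>)-\<epsilon>\<^esup>\<close> at \<open>x\<close>.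

  By the second estimate, a point of exponent at most \<open>\<alpha> < 1/2 + 1/(2\<mu>)\<close> is rational or lies within \<open>q\<^sup>-\<^sup>\<mu>\<close> of
  infinitely many \<open>p/q\<close>; for \<open>\<alpha> = 3/4\<close> one takes \<open>\<mu> = 2\<close> and uses Dirichlet's theorem instead. By the first
  estimate, the image of that neighbourhood of \<open>p/q\<close> has diameter about \<open>q\<^bsup>-(1+\<mu>)/2\<^esup>\<close>, and
  \<open>\<Sum>\<^sub>q q \<cdot> q\<^bsup>-s(1+\<mu>)/2\<^esup>\<close> converges for \<open>s > 4/(1+\<mu>)\<close>. Letting \<open>\<mu>\<close> tend to \<open>1/(2\<alpha>-1)\<close> gives \<open>(4\<alpha>-2)/\<alpha>\<close>.
\<close>


section \<open>Quadratic Weyl sums\<close>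

definition weyl_sum :: "nat \<Rightarrow> real \<Rightarrow> complex" where
  "weyl_sum N x = (\<Sum>k=1..N. cis (2 * pi * (real k)\<^sup>2 * x))"

section \<open>Geometric sums and Weyl differencing\<close>

lemma sin_pi_ge:
  assumes "0 \<le> z" "z \<le> 1/2"
  shows "z \<le> sin (pi * z)"
proof (cases "z \<le> 1/3")
  case True
  show ?thesis
  proof (cases "z = 0")
    case False
    with assms have z: "0 < z" by simp
    have "\<exists>\<xi>>0. \<xi> < pi * z \<and> sin (pi * z) - sin 0 = (pi * z - 0) * cos \<xi>"
      by (rule MVT2) (use z in \<open>auto intro!: derivative_eq_intros\<close>)
    then obtain \<xi> where \<xi>: "0 < \<xi>" "\<xi> < pi * z" "sin (pi * z) = pi * z * cos \<xi>" by auto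
    have "pi * z \<le> pi / 3" using True by simp
    then have "cos (pi / 3) \<le> cos \<xi>" using \<xi> by (intro cos_monotone_0_pi_le) linarith+
    then have "1/2 \<le> cos \<xi>" by (simp add: cos_60)
    moreover have "2 \<le> pi" by (rule pi_ge_two)
    ultimately have "2 * (1/2) \<le> pi * cos \<xi>" by (intro mult_mono) auto
    then have "z * 1 \<le> z * (pi * cos \<xi>)" using z by (intro mult_left_mono) auto
    then show ?thesis using \<xi>(3) by (simp add: mult_ac)
  qed auto
next
  case False
  have "sin (pi / 6) \<le> sin (pi * z)"
    using assms False by (intro sin_monotone_2pi_le) auto
  then show ?thesis using assms by (simp add: sin_30)
qed

text \<open>The ratio \<open>w\<close> satisfies |w - 1| = 2 sin(pi |z|), which by
  \<open>sin_pi_ge\<close> is at least twice the distance min(|z|, 1 - |z|) from \<open>z\<close> to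
  the integers. The reciprocal of this minimum is replaced by the sum of both reciprocals, which can
  be summed over residues without a case split.\<close>

lemma norm_geometric_cis_le:
  assumes "0 < \<bar>z\<bar>" "\<bar>z\<bar> < 1"
  shows "norm (\<Sum>b=1..M. cis (2 * pi * real b * z)) \<le> 1 / \<bar>z\<bar> + 1 / (1 - \<bar>z\<bar>)"
proof -
  define w where "w = cis (2 * pi * z)"
  have w: "cis (2 * pi * real b * z) = w ^ b" for b
    using Complex.DeMoivre[of "2 * pi * z" b] by (simp add: w_def mult_ac)
  have "(w - 1) * (\<Sum>b=1..M. w ^ b) = w ^ Suc M - w"
    by (induction M) (auto simp: algebra_simps)
  then have "norm (w - 1) * norm (\<Sum>b=1..M. w ^ b) = norm (w ^ Suc M - w)"
    by (metis norm_mult)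
  also have "\<dots> \<le> norm (w ^ Suc M) + norm w" by (rule norm_triangle_ineq4)
  also have "\<dots> = 2" by (simp add: w_def norm_power norm_mult)
  finally have A: "norm (w - 1) * norm (\<Sum>b=1..M. w ^ b) \<le> 2" .
  have B: "norm (w - 1) = 2 * sin (pi * \<bar>z\<bar>)"
  proof -
    have "norm (w - 1) = 2 * \<bar>sin (pi * z)\<bar>"
      using dist_exp_i_1[of "2 * pi * z"] by (simp add: w_def cis_conv_exp mult_ac)
    also have "\<bar>sin (pi * z)\<bar> = \<bar>sin (pi * \<bar>z\<bar>)\<bar>" by (cases "z \<ge> 0") auto
    also have "\<dots> = sin (pi * \<bar>z\<bar>)" using assms by (intro abs_of_nonneg sin_ge_zero) auto
    finally show ?thesis .
  qed
  define m where "m = min \<bar>z\<bar> (1 - \<bar>z\<bar>)"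
  have m: "m > 0" using assms by (auto simp: m_def)
  have "m \<le> sin (pi * \<bar>z\<bar>)"
  proof (cases "\<bar>z\<bar> \<le> 1/2")
    case True
    then show ?thesis using sin_pi_ge[of "\<bar>z\<bar>"] by (auto simp: m_def)
  next
    case False
    have "1 - \<bar>z\<bar> \<le> sin (pi * (1 - \<bar>z\<bar>))" using False assms by (intro sin_pi_ge) auto
    also have "\<dots> = sin (pi * \<bar>z\<bar>)" by (simp add: right_diff_distrib)
    finally show ?thesis by (auto simp: m_def)
  qed
  then have "(2 * m) * norm (\<Sum>b=1..M. w ^ b) \<le> 2"
    using A B by (smt (verit) mult_right_mono norm_ge_zero)
  then have "norm (\<Sum>b=1..M. w ^ b) \<le> 1 / m" using m by (simp add: field_simps)
  also have "\<dots> \<le> 1 / \<bar>z\<bar> + 1 / (1 - \<bar>z\<bar>)" using assms by (auto simp: m_def min_def)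
  finally show ?thesis by (simp add: w)
qed

text \<open>In the double sum for |S_N|^2 the diagonal gives N and the two triangles are conjugate.
  For a pair (b + d, b) the difference of squares is d^2 + 2bd, hence linear in \<open>b\<close>,
  and the factor that depends on d^2 has modulus 1.\<close>

lemma weyl_differencing:
  "(norm (weyl_sum N x))\<^sup>2 \<le> real N + 2 * (\<Sum>d=1..N. norm (\<Sum>b=1..N-d. cis (2 * pi * real b * (real (2*d) * x))))"
proof -
  define e where "e k = cis (2 * pi * (real k)\<^sup>2 * x)" for k
  define T where "T = {p. fst p \<in> {1..N} \<and> snd p \<in> {1..N} \<and> snd p < fst p}"
  define T' where "T' = {p. fst p \<in> {1..N} \<and> snd p \<in> {1..N} \<and> fst p < snd p}"
  define D where "D = (\<lambda>k. (k, k)) ` {1..N}"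
  define f where "f p = e (fst p) * cnj (e (snd p))" for p
  have fin: "finite T" "finite T'" "finite D"
    by (auto simp: T_def T'_def D_def intro: finite_subset[of _ "{1..N} \<times> {1..N}"])
  have split: "{1..N} \<times> {1..N} = D \<union> (T \<union> T')"
    by (auto simp: T_def T'_def D_def image_iff) 
  have "complex_of_real ((norm (weyl_sum N x))\<^sup>2) = weyl_sum N x * cnj (weyl_sum N x)"
    by (rule complex_norm_square)
  also have "\<dots> = (\<Sum>p\<in>{1..N} \<times> {1..N}. f p)"
    by (simp add: weyl_sum_def f_def e_def sum_product sum.cartesian_product case_prod_beta)
  also have "\<dots> = sum f D + (sum f T + sum f T')"
    unfolding split using fin
    by (subst sum.union_disjoint sum.union_disjoint, auto simp: T_def T'_def D_def)+
  also have "sum f D = of_nat N"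
  proof -
    have "sum f D = (\<Sum>k\<in>{1..N}. f (k, k))"
      unfolding D_def by (subst sum.reindex) (auto simp: inj_on_def)
    also have "\<dots> = (\<Sum>k\<in>{1..N}. 1)"
      by (rule sum.cong) (auto simp: f_def e_def cis_cnj simp flip: cis_inverse)
    finally show ?thesis by simp
  qed
  also have "sum f T' = cnj (sum f T)"
    unfolding cnj_sum
    by (rule sum.reindex_bij_witness[of _ prod.swap prod.swap]) (auto simp: T_def T'_def f_def)
  finally have "norm (complex_of_real ((norm (weyl_sum N x))\<^sup>2)) = norm (of_nat N + (sum f T + cnj (sum f T)))"
    by simp
  also have "\<dots> \<le> real N + 2 * norm (sum f T)"
    using norm_triangle_ineq[of "of_nat N" "sum f T + cnj (sum f T)"]
      norm_triangle_ineq[of "sum f T" "cnj (sum f T)"]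
    by (simp del: cnj_sum)
  also have "sum f T = (\<Sum>p\<in>(SIGMA d:{1..N}. {1..N-d}). f (snd p + fst p, snd p))"
    by (rule sum.reindex_bij_witness[of _ "\<lambda>p. (snd p + fst p, snd p)" "\<lambda>p. (fst p - snd p, snd p)"])
       (auto simp: T_def)
  also have "\<dots> = (\<Sum>d=1..N. \<Sum>b=1..N-d. f (b + d, b))"
    by (subst sum.Sigma) (auto simp: case_prod_beta)
  also have "\<dots> = (\<Sum>d=1..N. cis (2 * pi * (real d)\<^sup>2 * x) * (\<Sum>b=1..N-d. cis (2 * pi * real b * (real (2*d) * x))))"
    by (intro sum.cong refl)
       (auto simp: f_def e_def sum_distrib_left cis_cnj cis_mult algebra_simps power2_eq_square intro!: sum.cong arg_cong[of _ _ cis])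
  also have "norm \<dots> \<le> (\<Sum>d=1..N. norm (\<Sum>b=1..N-d. cis (2 * pi * real b * (real (2*d) * x))))"
    by (rule sum_norm_le) (auto simp: norm_mult)
  finally show ?thesis by (simp only: norm_of_real abs_of_nonneg[OF zero_le_power2])
qed

lemma harmonic_sum_le: "(\<Sum>k=1..n. 1 / real k) \<le> 1 + ln (real (max 1 n))"
proof (induction n)
  case (Suc n)
  show ?case
  proof (cases "n = 0")
    case False
    then have "ln (real n / real (Suc n)) \<le> real n / real (Suc n) - 1"
      by (intro ln_le_minus_one) auto
    with False have "1 / real (Suc n) \<le> ln (real (Suc n)) - ln (real n)"
      by (simp add: ln_div field_simps)
    with Suc False show ?thesis by (simp add: max_def split: if_splits)
  qed auto
qed auto


section \<open>Distribution of the differenced frequencies modulo \<open>q\<close>\<close>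

text \<open>Multiplication by \<open>p\<close> permutes the residues modulo \<open>q\<close>, so
  each of the \<open>B\<close> blocks of \<open>q\<close> consecutive \<open>m\<close> contributes
  the full sum over the residues.\<close>

lemma sum_mult_mod_blocks:
  fixes f :: "nat \<Rightarrow> real" and p :: int
  assumes "coprime p (int q)" "0 < q"
  shows "(\<Sum>m<B*q. f (nat ((int m * p) mod int q))) = real B * (\<Sum>r<q. f r)"
proof -
  have blk: "(\<Sum>m\<in>{b*q..<b*q+q}. f (nat ((int m * p) mod int q))) = (\<Sum>r<q. f r)" for b
  proof -
    let ?g = "\<lambda>i. nat ((int i * p) mod int q)"
    have inj: "inj_on ?g {..<q}"
    proof (rule inj_onI)
      fix i j assume ij: "i \<in> {..<q}" "j \<in> {..<q}" "?g i = ?g j"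
      then have "(int i * p) mod int q = (int j * p) mod int q"
        using assms by (simp add: nat_eq_iff)
      then have "int q dvd (int i - int j) * p"
        by (simp add: mod_eq_dvd_iff left_diff_distrib)
      then have "int q dvd int i - int j"
        using assms(1) by (simp add: coprime_dvd_mult_left_iff coprime_commute)
      then have "int i mod int q = int j mod int q" by (simp add: mod_eq_dvd_iff)
      with ij show "i = j" by simp
    qed
    have sub: "?g ` {..<q} \<subseteq> {..<q}"
      using assms(2) by (auto simp: nat_less_iff)
    have im: "?g ` {..<q} = {..<q}"
      by (rule card_subset_eq) (use sub inj in \<open>auto simp: card_image\<close>)
    have shift: "?g (i + b*q) = ?g i" for i
    proof -
      have "int (i + b*q) * p = int i * p + (int b * p) * int q" by (simp add: algebra_simps)
      then show ?thesis by (simp only: mod_mult_self1)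
    qed
    have "(\<Sum>m\<in>{b*q..<b*q+q}. f (?g m)) = (\<Sum>i<q. f (?g (i + b*q)))"
      by (rule sum.reindex_bij_witness[of _ "\<lambda>i. i + b*q" "\<lambda>m. m - b*q"]) auto
    also have "\<dots> = (\<Sum>i<q. f (?g i))" by (simp only: shift)
    also have "\<dots> = sum f (?g ` {..<q})" by (simp add: sum.reindex[OF inj])
    finally show ?thesis by (simp add: im)
  qed
  have "(\<Sum>m<B*q. f (nat ((int m * p) mod int q)))
      = (\<Sum>b<B. \<Sum>m\<in>{b*q..<b*q+q}. f (nat ((int m * p) mod int q)))"
    using sum.nat_group[of "\<lambda>m. f (nat ((int m * p) mod int q))" q B] by simp
  also have "\<dots> = real B * (\<Sum>r<q. f r)" by (simp add: blk)
  finally show ?thesis .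
qed

lemma sum_dvd_atLeastAtMost:
  fixes E :: "nat \<Rightarrow> real"
  assumes "0 < q"
  shows "(\<Sum>m\<in>{m\<in>{1..M}. q dvd m}. E m) = (\<Sum>l=1..M div q. E (q * l))"
  using assms
  by (intro sum.reindex_bij_witness[of _ "\<lambda>l. q * l" "\<lambda>m. m div q"])
     (auto simp: div_le_mono dvd_imp_le div_greater_zero_iff less_eq_div_iff_mult_less_eq mult.commute Suc_le_eq)

text \<open>The reflection r -> q - r turns the second half of the terms into the first, which
  leaves two harmonic sums. The residue 0 gets weight 0 because the multiples of \<open>q\<close>
  are estimated separately.\<close>

lemma sum_reflected_reciprocals_le:
  assumes "0 < q"
  shows "(\<Sum>r<q. if r = 0 then 0 else 2 * real q / real r + 2 * real q / (real q - real r))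
     \<le> 4 * real q * (1 + ln (real q))"
proof -
  have "(\<Sum>r<q. if r = 0 then 0 else 2 * real q / real r + 2 * real q / (real q - real r))
      = (\<Sum>r=1..q-1. 2 * real q / real r + 2 * real q / (real q - real r))"
    using assms by (intro sum.mono_neutral_cong_right) auto
  also have "\<dots> = (\<Sum>r=1..q-1. 2 * real q / real r) + (\<Sum>r=1..q-1. 2 * real q / (real q - real r))"
    by (rule sum.distrib)
  also have "(\<Sum>r=1..q-1. 2 * real q / (real q - real r)) = (\<Sum>r=1..q-1. 2 * real q / real r)"
    by (rule sum.reindex_bij_witness[of _ "\<lambda>r. q - r" "\<lambda>r. q - r"]) (auto simp: of_nat_diff)
  also have "(\<Sum>r=1..q-1. 2 * real q / real r) = 2 * real q * (\<Sum>r=1..q-1. 1 / real r)"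
    by (simp add: sum_distrib_left)
  finally have eq: "(\<Sum>r<q. if r = 0 then 0 else 2 * real q / real r + 2 * real q / (real q - real r))
      = 4 * real q * (\<Sum>r=1..q-1. 1 / real r)" by (simp add: algebra_simps)
  have "(\<Sum>r=1..q-1. 1 / real r) \<le> 1 + ln (real (max 1 (q - 1)))" by (rule harmonic_sum_le)
  also have "ln (real (max 1 (q - 1))) \<le> ln (real q)" using assms by (subst ln_le_cancel_iff) auto
  finally have "(\<Sum>r=1..q-1. 1 / real r) \<le> 1 + ln (real q)" by simp
  then show ?thesis unfolding eq by (intro mult_left_mono) auto
qed

text \<open>Modulo 1, m x equals z = r/q + m d with d = x - p/q, and the hypotheses give |m d| <=
  1/(2q), half the spacing of the residues. So for r > 0 both z and 1 - z keep at least half of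
  their unperturbed value, while for r = 0 only z = m d is left, with |z| <= 1/2.\<close>

lemma norm_differenced_sum_le:
  assumes "0 < q" "0 < N" and \<delta>: "\<bar>x - of_int p / real q\<bar> \<le> 1 / (4 * real q * real N)"
    and m: "1 \<le> m" "m \<le> 2 * N"
    and r: "r = nat ((int m * p) mod int q)"
  shows "r \<noteq> 0 \<Longrightarrow> norm (\<Sum>b=1..M. cis (2 * pi * real b * (real m * x)))
           \<le> 2 * real q / real r + 2 * real q / (real q - real r)" (is "_ \<Longrightarrow> ?A")
    and "r = 0 \<Longrightarrow> x \<noteq> of_int p / real q \<Longrightarrow> norm (\<Sum>b=1..M. cis (2 * pi * real b * (real m * x)))
           \<le> 2 / (real m * \<bar>x - of_int p / real q\<bar>)" (is "_ \<Longrightarrow> _ \<Longrightarrow> ?B")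
proof -
  define d where "d = x - of_int p / real q"
  define z where "z = real r / real q + real m * d"
  define n where "n = (int m * p) div int q"
  have "int m * p = int q * n + int r" using assms(1) by (simp add: n_def r)
  then have "real m * of_int p = real q * of_int n + real r"
    by (metis of_int_add of_int_mult of_int_of_nat_eq)
  then have mx: "real m * x = of_int n + z"
    using assms(1) by (simp add: z_def d_def field_simps)
  have per: "cis (2 * pi * real b * (real m * x)) = cis (2 * pi * real b * z)" for b
  proof -
    have "cis (2 * pi * real b * (real m * x)) = cis (2 * pi * real b * z) * cis (2 * pi * of_int (int b * n))"
      by (simp only: mx cis_mult) (simp add: algebra_simps)
    also have "cis (2 * pi * of_int (int b * n)) = 1" by (rule cis_multiple_2pi) auto
    finally show ?thesis by simp
  qed
  have "\<bar>real m * d\<bar> \<le> real (2 * N) * (1 / (4 * real q * real N))"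
    unfolding abs_mult using m \<delta> by (intro mult_mono) (auto simp: d_def)
  then have md: "\<bar>real m * d\<bar> \<le> 1 / (2 * real q)" using assms by simp
  have rq: "real r + 1 \<le> real q"
  proof -
    have "r < q" using assms(1) by (simp add: r nat_less_iff)
    then show ?thesis by linarith
  qed
  show ?A if "r \<noteq> 0"
  proof -
    have r1: "1 \<le> real r" using that by simp
    have z1: "real r / (2 * real q) \<le> z"
    proof -
      have "real r / (2 * real q) \<le> real r / real q - 1 / (2 * real q)"
        using r1 assms(1) by (simp add: field_simps)
      then show ?thesis using md by (simp add: z_def)
    qed
    have z2: "(real q - real r) / (2 * real q) \<le> 1 - z"
    proof -
      have "1 - real r / real q - 1 / (2 * real q) = (2 * (real q - real r) - 1) / (2 * real q)"
        using assms(1) by (simp add: field_simps)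
      then have "(real q - real r) / (2 * real q) \<le> 1 - real r / real q - 1 / (2 * real q)"
        using rq by (simp add: divide_right_mono)
      then show ?thesis using md by (simp add: z_def)
    qed
    have p1: "0 < real r / (2 * real q)" using r1 assms(1) by simp
    have p2: "0 < (real q - real r) / (2 * real q)" using rq assms(1) by simp
    have "norm (\<Sum>b=1..M. cis (2 * pi * real b * z)) \<le> 1 / \<bar>z\<bar> + 1 / (1 - \<bar>z\<bar>)"
      by (rule norm_geometric_cis_le) (use z1 z2 p1 p2 in linarith)+
    also have "\<dots> = 1 / z + 1 / (1 - z)" using z1 p1 by simp
    also have "\<dots> \<le> 1 / (real r / (2 * real q)) + 1 / ((real q - real r) / (2 * real q))"
      using z1 z2 p1 p2 by (intro add_mono divide_left_mono mult_pos_pos) linarith+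
    finally show ?thesis unfolding per by (simp add: mult.commute)
  qed
  show ?B if "r = 0" "x \<noteq> of_int p / real q"
  proof -
    have z: "z = real m * d" using that by (simp add: z_def)
    have d: "d \<noteq> 0" using that by (simp add: d_def)
    have "1 / (2 * real q) \<le> 1 / 2" using assms(1) by simp
    with md have zh: "\<bar>z\<bar> \<le> 1 / 2" unfolding z by linarith
    have z0: "0 < \<bar>z\<bar>" using d m by (simp add: z)
    have "norm (\<Sum>b=1..M. cis (2 * pi * real b * z)) \<le> 1 / \<bar>z\<bar> + 1 / (1 - \<bar>z\<bar>)"
      by (rule norm_geometric_cis_le) (use z0 zh in linarith)+
    also have "1 / (1 - \<bar>z\<bar>) \<le> 1 / \<bar>z\<bar>" using z0 zh by (intro divide_left_mono mult_pos_pos) linarith+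
    finally show ?thesis by (simp add: per z abs_mult d_def)
  qed
qed


text \<open>
  After differencing, the sum over \<open>b\<close> is large only if \<open>2dx\<close> is close to an integer. As \<open>|x - p/q| \<le> 1/(4qN)\<close>,
  for \<open>q\<close> not dividing \<open>2d\<close> this closeness is read off the residue of \<open>2dp\<close> modulo \<open>q\<close>, and each residue is
  taken equally often; the remaining \<open>d\<close> are left to the bound \<open>E\<close>.
\<close>
lemma weyl_sum_bound_aux:
  fixes p :: int and E :: "nat \<Rightarrow> real"
  assumes cop: "coprime p (int q)" and q: "0 < q" "q \<le> 4 * N" and N: "0 < N"
    and \<delta>: "\<bar>x - of_int p / real q\<bar> \<le> 1 / (4 * real q * real N)"
    and E0: "\<And>m. 0 \<le> E m"
    and E: "\<And>d. d \<in> {1..N} \<Longrightarrow> q dvd 2 * d \<Longrightarrow>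
      norm (\<Sum>b=1..N-d. cis (2 * pi * real b * (real (2*d) * x))) \<le> E (2 * d)"
  shows "(norm (weyl_sum N x))\<^sup>2 \<le> real N + 2 * (\<Sum>l=1..2*N div q. E (q * l)) + 144 * real N * (1 + ln (real N))"
proof -
  have lnN: "0 \<le> ln (real N)" using N by simp
  define g where "g m = nat ((int m * p) mod int q)" for m
  define f where "f r = (if r = 0 then 0 else 2 * real q / real r + 2 * real q / (real q - real r))" for r
  define T where "T d = norm (\<Sum>b=1..N-d. cis (2 * pi * real b * (real (2*d) * x)))" for d
  define F where "F m = (if q dvd m then E m else 0) + f (g m)" for m
  have g_less: "g m < q" for m using q by (simp add: g_def nat_less_iff)
  have g0: "g m = 0 \<longleftrightarrow> q dvd m" for m
  proof -
    have "(int m * p) mod int q \<ge> 0" using q by simp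
    then have "g m = 0 \<longleftrightarrow> int q dvd int m * p"
      unfolding g_def by (metis dvd_eq_mod_eq_0 eq_nat_nat_iff nat_0 order_refl)
    also have "\<dots> \<longleftrightarrow> int q dvd int m"
      using cop by (simp add: coprime_dvd_mult_left_iff coprime_commute)
    finally show ?thesis by simp
  qed
  have f_nn: "0 \<le> f (g m)" for m using g_less[of m] by (auto simp: f_def)
  have F_nn: "0 \<le> F m" for m using f_nn E0 by (auto simp: F_def)
  have TF: "T d \<le> F (2 * d)" if "d \<in> {1..N}" for d
  proof (cases "q dvd 2 * d")
    case True
    then show ?thesis using E[OF that] f_nn[of "2*d"] by (auto simp: T_def F_def)
  next
    case False
    have "T d \<le> 2 * real q / real (g (2*d)) + 2 * real q / (real q - real (g (2*d)))"
      unfolding T_def using that g0[of "2*d"] False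
      by (intro norm_differenced_sum_le(1)[OF q(1) N \<delta>]) (auto simp: g_def)
    then show ?thesis using False g0[of "2*d"] by (simp add: F_def f_def)
  qed
  have "(\<Sum>d=1..N. T d) \<le> (\<Sum>d=1..N. F (2 * d))" by (rule sum_mono) (rule TF)
  also have "\<dots> = sum F ((\<lambda>d. 2 * d) ` {1..N})" by (subst sum.reindex) (auto simp: inj_on_def)
  \<comment> \<open>The even numbers 2d are completed to all m <= 2N, at no cost for nonnegative
    terms. Multiplication by \<open>p\<close> alone then permutes the residues, whatever the parity
    of \<open>q\<close>.\<close>
  also have "\<dots> \<le> sum F {1..2*N}" by (rule sum_mono2) (auto simp: F_nn)
  also have "\<dots> = (\<Sum>m=1..2*N. if q dvd m then E m else 0) + (\<Sum>m=1..2*N. f (g m))"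
    unfolding F_def by (rule sum.distrib)
  also have "(\<Sum>m=1..2*N. if q dvd m then E m else 0) = (\<Sum>m\<in>{m\<in>{1..2*N}. q dvd m}. E m)"
    by (subst sum.inter_filter) auto
  also have "\<dots> = (\<Sum>l=1..2*N div q. E (q * l))" by (rule sum_dvd_atLeastAtMost[OF q(1)])
  also have "(\<Sum>m=1..2*N. f (g m)) \<le> 72 * real N * (1 + ln (real N))"
  proof -
    define B where "B = 2 * N div q + 1"
    have lt: "2 * N < B * q"
      using q(1) unfolding B_def by (metis dividend_less_times_div add.commute mult.commute Suc_eq_plus1 mult_Suc_right)
    have "(\<Sum>m=1..2*N. f (g m)) \<le> (\<Sum>m<B*q. f (g m))"
      by (rule sum_mono2) (use lt f_nn in auto)
    also have "\<dots> = real B * (\<Sum>r<q. f r)" unfolding g_def by (rule sum_mult_mod_blocks[OF cop q(1)])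
    also have "\<dots> \<le> real B * (4 * real q * (1 + ln (real q)))"
      unfolding f_def by (intro mult_left_mono sum_reflected_reciprocals_le q) auto
    also have "\<dots> = 4 * (real B * real q) * (1 + ln (real q))" by (simp add: algebra_simps)
    \<comment> \<open>Here q <= 4N enters twice: B q <= 2N + q <= 6N, and ln q <= 2 ln 2 + ln N <= 2
      + ln N.\<close>
    also have "\<dots> \<le> (24 * real N) * (3 * (1 + ln (real N)))"
    proof (rule mult_mono)
      have "B * q = (2 * N div q) * q + q" by (simp add: B_def)
      also have "\<dots> \<le> 2 * N + 4 * N" using q by (intro add_mono) auto
      finally have "real (B * q) \<le> real (6 * N)" by (subst of_nat_le_iff) simp
      then show "4 * (real B * real q) \<le> 24 * real N" by simp
      have "ln (real q) \<le> ln (4 * real N)" using q by (subst ln_le_cancel_iff) auto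
      also have "\<dots> = ln 4 + ln (real N)" using N by (simp add: ln_mult)
      also have "ln (4::real) = 2 * ln 2" using ln_realpow[of 2 2] by simp
      finally show "1 + ln (real q) \<le> 3 * (1 + ln (real N))"
        using ln_le_minus_one[of "2::real"] lnN by simp
    qed (use q N in auto)
    also have "\<dots> = 72 * real N * (1 + ln (real N))" by simp
    finally show ?thesis .
  qed
  finally have "(\<Sum>d=1..N. T d) \<le> (\<Sum>l=1..2*N div q. E (q * l)) + 72 * real N * (1 + ln (real N))"
    by simp
  then show ?thesis using weyl_differencing[of N x] unfolding T_def by linarith
qed

section \<open>Two bounds for Weyl sums near a rational\<close>

text \<open>The inner sums with q | 2d are bounded trivially by N; at most 2N/q multiples of
  \<open>q\<close> occur, whence the term N^2/q.\<close>

lemma weyl_sum_bound_denominator: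
  fixes p :: int
  assumes "coprime p (int q)" and q: "0 < q" "q \<le> 4 * N" and N: "0 < N"
    and \<delta>: "\<bar>x - of_int p / real q\<bar> \<le> 1 / (4 * real q * real N)"
  shows "(norm (weyl_sum N x))\<^sup>2 \<le> 145 * (1 + ln (real N)) * (real N + (real N)\<^sup>2 / real q)"
proof -
  have "(norm (weyl_sum N x))\<^sup>2
      \<le> real N + 2 * (\<Sum>l=1..2*N div q. real N) + 144 * real N * (1 + ln (real N))"
  proof (rule weyl_sum_bound_aux[OF assms(1) q N \<delta>])
    fix d
    have "norm (\<Sum>b=1..N-d. cis (2 * pi * real b * (real (2*d) * x))) \<le> (\<Sum>b=1..N-d. 1)"
      by (rule sum_norm_le) auto
    then show "norm (\<Sum>b=1..N-d. cis (2 * pi * real b * (real (2*d) * x))) \<le> real N" by simp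
  qed auto
  also have "(\<Sum>l=1..2*N div q. real N) = real (2 * N div q) * real N" by simp
  also have "real (2 * N div q) \<le> 2 * real N / real q"
  proof -
    have "real (2 * N div q * q) \<le> real (2 * N)" by (subst of_nat_le_iff) (rule div_times_less_eq_dividend)
    then show ?thesis using q(1) by (simp add: field_simps)
  qed
  finally have *: "(norm (weyl_sum N x))\<^sup>2
      \<le> real N + 4 * ((real N)\<^sup>2 / real q) + 144 * real N * (1 + ln (real N))"
    using N by (simp add: power2_eq_square mult_right_mono)
  have L: "1 \<le> 1 + ln (real N)" using N by simp
  have "real N * 1 \<le> real N * (1 + ln (real N))" using L by (intro mult_left_mono) auto
  moreover have "(real N)\<^sup>2 / real q * 1 \<le> (real N)\<^sup>2 / real q * (1 + ln (real N))"
    using L by (intro mult_left_mono) auto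
  moreover have "0 \<le> (real N)\<^sup>2 / real q" by simp
  ultimately have "(norm (weyl_sum N x))\<^sup>2
      \<le> 145 * (real N * (1 + ln (real N))) + 145 * ((real N)\<^sup>2 / real q * (1 + ln (real N)))"
    using * by linarith
  then show ?thesis by (simp only: ring_distribs mult_ac)
qed

text \<open>With D the distance from x to p/q, the inner sum for m = q l is at most 2/(q l D), and
  summing over l gives 1/(q D) up to a logarithm. This improves on
  \<open>weyl_sum_bound_denominator\<close> when D > 1/N^2.\<close>

lemma weyl_sum_bound_distance:
  fixes p :: int
  assumes "coprime p (int q)" and q: "0 < q" "q \<le> 4 * N" and N: "0 < N"
    and \<delta>: "\<bar>x - of_int p / real q\<bar> \<le> 1 / (4 * real q * real N)"
    and ne: "x \<noteq> of_int p / real q"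
  shows "(norm (weyl_sum N x))\<^sup>2
    \<le> 145 * (1 + ln (real N)) * (real N + 1 / (real q * \<bar>x - of_int p / real q\<bar>))"
proof -
  define D where "D = \<bar>x - of_int p / real q\<bar>"
  have lnN: "0 \<le> ln (real N)" using N by simp
  have D: "0 < D" using ne by (simp add: D_def)
  have "(norm (weyl_sum N x))\<^sup>2
      \<le> real N + 2 * (\<Sum>l=1..2*N div q. 2 / (real (q * l) * D)) + 144 * real N * (1 + ln (real N))"
  proof (rule weyl_sum_bound_aux[OF assms(1) q N \<delta>])
    fix d assume d: "d \<in> {1..N}" "q dvd 2 * d"
    then have "nat ((int (2*d) * p) mod int q) = 0"
      by (metis dvd_eq_mod_eq_0 dvd_mult2 int_dvd_int_iff nat_0)
    then show "norm (\<Sum>b=1..N-d. cis (2 * pi * real b * (real (2*d) * x))) \<le> 2 / (real (2*d) * D)"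
      unfolding D_def using d by (intro norm_differenced_sum_le(2)[OF q(1) N \<delta> _ _ refl _ ne]) auto
  qed (use D in auto)
  also have "(\<Sum>l=1..2*N div q. 2 / (real (q * l) * D)) = 2 / (real q * D) * (\<Sum>l=1..2*N div q. 1 / real l)"
    by (simp add: sum_distrib_left mult_ac)
  also have "\<dots> \<le> 2 / (real q * D) * (2 * (1 + ln (real N)))"
  proof (intro mult_left_mono)
    have "(\<Sum>l=1..2*N div q. 1 / real l) \<le> 1 + ln (real (max 1 (2*N div q)))" by (rule harmonic_sum_le)
    also have "ln (real (max 1 (2*N div q))) \<le> ln (real (2 * N))"
    proof -
      have "max 1 (2*N div q) \<le> 2 * N" using N by (auto simp: div_le_dividend)
      then show ?thesis by (subst ln_le_cancel_iff) (use N in \<open>auto simp del: of_nat_mult\<close>)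
    qed
    also have "\<dots> = ln 2 + ln (real N)" using N by (simp add: ln_mult)
    finally have "(\<Sum>l=1..2*N div q. 1 / real l) \<le> 1 + (ln 2 + ln (real N))" by simp
    then show "(\<Sum>l=1..2*N div q. 1 / real l) \<le> 2 * (1 + ln (real N))"
      using ln_le_minus_one[of "2::real"] lnN by simp
  qed (use D in auto)
  also have "2 / (real q * D) * (2 * (1 + ln (real N))) = 4 * (1 / (real q * D) * (1 + ln (real N)))"
    by simp
  finally have *: "(norm (weyl_sum N x))\<^sup>2
      \<le> real N + 8 * (1 / (real q * D) * (1 + ln (real N))) + 144 * real N * (1 + ln (real N))"
    by simp
  have L: "1 \<le> 1 + ln (real N)" using N by simp
  have "real N * 1 \<le> real N * (1 + ln (real N))" using L by (intro mult_left_mono) auto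
  moreover have "0 \<le> 1 / (real q * D) * (1 + ln (real N))" using L D by (intro mult_nonneg_nonneg) auto
  moreover have "u + 8 * v + 144 * u' \<le> 145 * u' + 145 * v" if "u * 1 \<le> u'" "0 \<le> v" for u u' v :: real
    using that by simp
  ultimately have "(norm (weyl_sum N x))\<^sup>2
      \<le> 145 * (real N * (1 + ln (real N))) + 145 * (1 / (real q * D) * (1 + ln (real N)))"
    using order_trans[OF *] by (metis mult.assoc)
  then show ?thesis unfolding D_def[symmetric] by (simp only: ring_distribs mult_ac)
qed

section \<open>Increments of the Gauss series\<close>

text \<open>The imaginary part is Riemann's function, the sum of sin(k^2 y)/k^2, at y = 2 pi
  x.\<close>

definition gauss_series :: "real \<Rightarrow> complex" where
  "gauss_series x = (\<Sum>n. cis (2 * pi * (real (Suc n))\<^sup>2 * x) / (of_nat (Suc n))\<^sup>2)"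

lemma summable_gauss_series:
  "summable (\<lambda>n. cis (2 * pi * (real (Suc n))\<^sup>2 * x) / (of_nat (Suc n))\<^sup>2)"
proof (rule summable_comparison_test')
  show "summable (\<lambda>n. inverse ((real (Suc n))\<^sup>2))"
    using inverse_power_summable[of 2, where ?'a = real] by (subst summable_Suc_iff) simp
qed (simp add: norm_mult norm_inverse norm_power divide_inverse del: of_nat_Suc)

lemma reciprocal_square_diff_le:
  assumes "0 < k"
  shows "1 / (real k)\<^sup>2 - 1 / (real (Suc k))\<^sup>2 \<le> 2 / (real k) ^ 3"
proof -
  define t where "t = real k"
  have t: "0 < t" using assms by (simp add: t_def)
  have "1 / t\<^sup>2 - 1 / (t + 1)\<^sup>2 = (2 * t + 1) / (t\<^sup>2 * (t + 1)\<^sup>2)"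
    using t by (simp add: divide_simps) (simp add: power2_eq_square algebra_simps)
  also have "\<dots> \<le> 2 / t ^ 3"
  proof -
    have "(2 * t + 1) * t ^ 3 \<le> 2 * (t\<^sup>2 * (t + 1)\<^sup>2)"
      using t by (simp add: power2_eq_square power3_eq_cube algebra_simps)
    then show ?thesis using t by (simp add: divide_simps mult_ac)
  qed
  finally show ?thesis by (simp add: t_def add.commute)
qed

text \<open>The mean value theorem for t^(e-1) on [k, k+1], with the derivative estimated at the
  right end; the differences telescope in \<open>sum_powr_tail_le\<close>.\<close>

lemma powr_telescope_le:
  fixes e :: real
  assumes e: "0 < e" "e < 1" and k: "0 < k"
  shows "real (Suc k) powr (e - 2) \<le> (real k powr (e - 1) - real (Suc k) powr (e - 1)) / (1 - e)"
proof -
  have "\<exists>z>real k. z < real (Suc k) \<and> real (Suc k) powr (e - 1) - real k powr (e - 1)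
      = (real (Suc k) - real k) * ((e - 1) * z powr (e - 1 - 1))"
    by (rule MVT2) (use k in \<open>auto intro!: derivative_eq_intros\<close>)
  then obtain z where z: "real k < z" "z < real (Suc k)"
    "real (Suc k) powr (e - 1) - real k powr (e - 1) = (e - 1) * z powr (e - 2)"
    by auto
  have "real (Suc k) powr (e - 2) \<le> z powr (e - 2)"
    using z k e by (intro powr_mono2') auto
  then have "(1 - e) * real (Suc k) powr (e - 2) \<le> (1 - e) * z powr (e - 2)"
    using e by (intro mult_left_mono) auto
  also have "\<dots> = real k powr (e - 1) - real (Suc k) powr (e - 1)" using z(3) by (simp add: algebra_simps)
  finally show ?thesis using e by (simp add: field_simps)
qed

lemma sum_powr_tail_le:
  fixes e :: real
  assumes e: "0 < e" "e < 1" and K: "0 < K" "K \<le> M"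
  shows "(\<Sum>k=Suc K..M. real k powr (e - 2)) \<le> real K powr (e - 1) / (1 - e)"
proof -
  have "(\<Sum>k=Suc K..M. real k powr (e - 2)) \<le> (real K powr (e - 1) - real M powr (e - 1)) / (1 - e)"
    using K(2)
  proof (induction M rule: dec_induct)
    case (step n)
    then show ?case using powr_telescope_le[OF e, of n] K(1)
      by (simp add: diff_divide_distrib)
  qed simp
  also have "\<dots> \<le> real K powr (e - 1) / (1 - e)" using e by (intro divide_right_mono) auto
  finally show ?thesis .
qed

lemma weyl_sum_Suc: "weyl_sum (Suc N) x = weyl_sum N x + cis (2 * pi * (real (Suc N))\<^sup>2 * x)"
  by (simp add: weyl_sum_def)

text \<open>Abel summation. Weighting the boundary terms with the successor index makes both sides
  vanish at M = K, so that the induction starts there.\<close>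

lemma gauss_sum_by_parts:
  assumes "K \<le> M"
  shows "(\<Sum>k=Suc K..M. cis (2 * pi * (real k)\<^sup>2 * x) / (of_nat k)\<^sup>2)
    = weyl_sum M x * of_real (1 / (real (Suc M))\<^sup>2) - weyl_sum K x * of_real (1 / (real (Suc K))\<^sup>2)
      + (\<Sum>k=Suc K..M. weyl_sum k x * of_real (1 / (real k)\<^sup>2 - 1 / (real (Suc k))\<^sup>2))"
  using assms
proof (induction M rule: dec_induct)
  case (step n)
  define u v w where "u = complex_of_real (1 / (real (Suc n))\<^sup>2)"
    and "v = complex_of_real (1 / (real (Suc (Suc n)))\<^sup>2)"
    and "w = cis (2 * pi * (real (Suc n))\<^sup>2 * x)"
  have c: "w / (of_nat (Suc n))\<^sup>2 = w * u"
    by (simp add: u_def del: of_nat_Suc)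
  have d: "complex_of_real (1 / (real (Suc n))\<^sup>2 - 1 / (real (Suc (Suc n)))\<^sup>2) = u - v"
    by (simp only: u_def v_def of_real_diff)
  show ?case using step
    by (simp only: sum.atLeast_Suc_atMost_Suc_shift sum.cl_ivl_Suc Suc_le_mono le_SucI if_False not_less
        weyl_sum_Suc c d flip: u_def v_def w_def) (simp add: algebra_simps c d flip: u_def v_def w_def)
qed simp

text \<open>After partial summation each boundary term is at most A K^(e-1), and the remaining sum
  is dominated by 2A times the sum of k^(e-2). The factor \<open>A\<close> is kept free because it
  will carry the arithmetic gain: of order q^(-1/2) near p/q, and |h|^(1/(2\<mu>)) at badly
  approximable points.\<close>

lemma gauss_tail_bound:
  fixes e A :: real
  assumes e: "0 < e" "e < 1" and K: "0 < K" "K \<le> M" and A: "0 \<le> A"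
    and S: "\<And>k. K \<le> k \<Longrightarrow> norm (weyl_sum k x) \<le> A * real k powr (1 + e)"
  shows "norm (\<Sum>k=Suc K..M. cis (2 * pi * (real k)\<^sup>2 * x) / (of_nat k)\<^sup>2)
    \<le> (4 / (1 - e)) * A * real K powr (e - 1)"
proof -
  have pw: "real k powr (1 + e) / (real k)\<^sup>2 = real k powr (e - 1)" if "0 < k" for k
    using that by (simp add: powr_diff powr_add flip: powr_numeral) (simp add: field_simps power2_eq_square)
  have pw3: "real k powr (1 + e) / (real k) ^ 3 = real k powr (e - 2)" if "0 < k" for k
    using that by (simp add: powr_diff powr_add) (simp add: field_simps power2_eq_square power3_eq_cube)
  have ends: "norm (weyl_sum k x * of_real (1 / (real (Suc k))\<^sup>2)) \<le> A * real K powr (e - 1)"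
    if k: "K \<le> k" for k
  proof -
    have "norm (weyl_sum k x * of_real (1 / (real (Suc k))\<^sup>2)) = norm (weyl_sum k x) * (1 / (real (Suc k))\<^sup>2)"
      by (simp add: norm_mult norm_divide norm_power del: of_nat_Suc)
    also have "\<dots> \<le> (A * real k powr (1 + e)) * (1 / (real k)\<^sup>2)"
      using S[OF k] A K k by (intro mult_mono divide_left_mono power_mono) auto
    also have "\<dots> = A * real k powr (e - 1)" unfolding pw[of k, OF order_less_le_trans[OF K(1) k], symmetric] by simp
    also have "\<dots> \<le> A * real K powr (e - 1)"
      using A K k e by (intro mult_left_mono powr_mono2') auto
    finally show ?thesis .
  qed
  have mid: "norm (\<Sum>k=Suc K..M. weyl_sum k x * of_real (1 / (real k)\<^sup>2 - 1 / (real (Suc k))\<^sup>2))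
      \<le> 2 * A * (real K powr (e - 1) / (1 - e))"
  proof -
    have "norm (\<Sum>k=Suc K..M. weyl_sum k x * of_real (1 / (real k)\<^sup>2 - 1 / (real (Suc k))\<^sup>2))
      \<le> (\<Sum>k=Suc K..M. 2 * A * real k powr (e - 2))"
    proof (rule sum_norm_le)
      fix k assume "k \<in> {Suc K..M}"
      then have k: "K \<le> k" "0 < k" by auto
      have nn: "0 \<le> 1 / (real k)\<^sup>2 - 1 / (real (Suc k))\<^sup>2"
        using k by (simp add: divide_simps power_mono)
      have "norm (weyl_sum k x * of_real (1 / (real k)\<^sup>2 - 1 / (real (Suc k))\<^sup>2))
          = norm (weyl_sum k x) * (1 / (real k)\<^sup>2 - 1 / (real (Suc k))\<^sup>2)"
        by (simp only: norm_mult norm_of_real abs_of_nonneg[OF nn])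
      also have "\<dots> \<le> (A * real k powr (1 + e)) * (2 / (real k) ^ 3)"
        using S[OF k(1)] A nn reciprocal_square_diff_le[OF k(2)] by (intro mult_mono) auto
      also have "\<dots> = 2 * A * real k powr (e - 2)" unfolding pw3[OF k(2), symmetric] by simp
      finally show "norm (weyl_sum k x * of_real (1 / (real k)\<^sup>2 - 1 / (real (Suc k))\<^sup>2))
          \<le> 2 * A * real k powr (e - 2)" .
    qed
    also have "\<dots> = 2 * A * (\<Sum>k=Suc K..M. real k powr (e - 2))" by (simp add: sum_distrib_left)
    also have "\<dots> \<le> 2 * A * (real K powr (e - 1) / (1 - e))"
      using A by (intro mult_left_mono sum_powr_tail_le e K) auto
    finally show ?thesis .
  qed
  have "norm (\<Sum>k=Suc K..M. cis (2 * pi * (real k)\<^sup>2 * x) / (of_nat k)\<^sup>2)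
      \<le> A * real K powr (e - 1) + A * real K powr (e - 1) + 2 * A * (real K powr (e - 1) / (1 - e))"
    unfolding gauss_sum_by_parts[OF K(2)]
    using norm_triangle_mono[OF order_trans[OF norm_triangle_ineq4 add_mono[OF ends[OF K(2)] ends[OF order_refl]]] mid] .
  also have "\<dots> \<le> (4 / (1 - e)) * A * real K powr (e - 1)"
  proof -
    define w where "w = A * real K powr (e - 1)"
    have "w \<le> w / (1 - e)" using A e by (simp add: w_def field_simps)
    then have "w + w + 2 * (w / (1 - e)) \<le> 4 * (w / (1 - e))" by linarith
    then show ?thesis by (simp add: w_def mult_ac)
  qed
  finally show ?thesis .
qed

lemma gauss_series_tail_bound:
  fixes e A :: real
  assumes e: "0 < e" "e < 1" and K: "0 < K" and A: "0 \<le> A"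
    and S: "\<And>k. K \<le> k \<Longrightarrow> norm (weyl_sum k x) \<le> A * real k powr (1 + e)"
  shows "norm (gauss_series x - (\<Sum>k=1..K. cis (2 * pi * (real k)\<^sup>2 * x) / (of_nat k)\<^sup>2))
    \<le> (4 / (1 - e)) * A * real K powr (e - 1)"
proof (rule tendsto_upperbound)
  let ?s = "\<lambda>M. \<Sum>k=1..M. cis (2 * pi * (real k)\<^sup>2 * x) / (of_nat k)\<^sup>2"
  have "(\<lambda>n. \<Sum>i<n. cis (2 * pi * (real (Suc i))\<^sup>2 * x) / (of_nat (Suc i))\<^sup>2) \<longlonglongrightarrow> gauss_series x"
    unfolding gauss_series_def by (rule summable_LIMSEQ[OF summable_gauss_series])
  moreover have "(\<Sum>i<n. cis (2 * pi * (real (Suc i))\<^sup>2 * x) / (of_nat (Suc i))\<^sup>2) = ?s n" for n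
    by (rule sum.reindex_bij_witness[of _ "\<lambda>i. i - 1" Suc]) auto
  ultimately have "?s \<longlonglongrightarrow> gauss_series x" by simp
  then show "(\<lambda>M. norm (?s M - ?s K)) \<longlonglongrightarrow> norm (gauss_series x - ?s K)"
    by (intro tendsto_intros)
  show "\<forall>\<^sub>F M in sequentially. norm (?s M - ?s K) \<le> (4 / (1 - e)) * A * real K powr (e - 1)"
    using eventually_ge_at_top[of K]
  proof eventually_elim
    case (elim M)
    have "?s M = ?s K + (\<Sum>k=Suc K..M. cis (2 * pi * (real k)\<^sup>2 * x) / (of_nat k)\<^sup>2)"
      using sum.ub_add_nat[of 1 K "\<lambda>k. cis (2 * pi * (real k)\<^sup>2 * x) / (of_nat k)\<^sup>2" "M - K"] elim
      by simp
    then show ?case using gauss_tail_bound[OF e K elim A S] by simp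
  qed
qed simp

text \<open>Differentiation cancels the denominators k^2: the derivative of the partial sum is 2 pi
  i S_K, and the mean value inequality applies.\<close>

lemma gauss_partial_sum_diff:
  assumes B: "\<And>y. y \<in> closed_segment x (x + h) \<Longrightarrow> norm (weyl_sum K y) \<le> B"
  shows "norm ((\<Sum>k=1..K. cis (2 * pi * (real k)\<^sup>2 * (x + h)) / (of_nat k)\<^sup>2)
     - (\<Sum>k=1..K. cis (2 * pi * (real k)\<^sup>2 * x) / (of_nat k)\<^sup>2)) \<le> 2 * pi * B * \<bar>h\<bar>"
proof -
  let ?f = "\<lambda>y::real. \<Sum>k=1..K. cis (2 * pi * (real k)\<^sup>2 * y) / (of_nat k)\<^sup>2"
  have 1: "((\<lambda>y. cis (2 * pi * (real k)\<^sup>2 * y) / (of_nat k)\<^sup>2) has_vector_derivative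
      (2 * pi) *\<^sub>R (\<i> * cis (2 * pi * (real k)\<^sup>2 * y))) (at y within S)" if "k \<in> {1..K}" for k y S
  proof -
    have "((\<lambda>y. cis (2 * pi * (real k)\<^sup>2 * y)) has_vector_derivative
      (2 * pi * (real k)\<^sup>2) *\<^sub>R (\<i> * cis (2 * pi * (real k)\<^sup>2 * y))) (at y within S)"
      unfolding has_vector_derivative_def
      by (auto intro!: derivative_eq_intros simp: scaleR_conv_of_real algebra_simps)
    then have "((\<lambda>y. cis (2 * pi * (real k)\<^sup>2 * y) * (1 / (of_nat k)\<^sup>2)) has_vector_derivative
      ((2 * pi * (real k)\<^sup>2) *\<^sub>R (\<i> * cis (2 * pi * (real k)\<^sup>2 * y))) * (1 / (of_nat k)\<^sup>2)) (at y within S)"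
      by (rule has_vector_derivative_mult_left)
    then show ?thesis using that by (simp add: scaleR_conv_of_real mult.assoc)
  qed
  have "(?f has_vector_derivative (\<Sum>k=1..K. (2 * pi) *\<^sub>R (\<i> * cis (2 * pi * (real k)\<^sup>2 * y)))) (at y within S)" for y S
    by (rule has_vector_derivative_sum) (rule 1)
  moreover have "(\<Sum>k=1..K. (2 * pi) *\<^sub>R (\<i> * cis (2 * pi * (real k)\<^sup>2 * y))) = (2 * pi) *\<^sub>R (\<i> * weyl_sum K y)" for y
    unfolding weyl_sum_def by (simp add: scaleR_sum_right sum_distrib_left)
  ultimately have "(?f has_derivative (\<lambda>t. t *\<^sub>R ((2 * pi) *\<^sub>R (\<i> * weyl_sum K y)))) (at y within S)" for y S
    by (simp add: has_vector_derivative_def)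
  then have "norm (?f (x + h) - ?f x) \<le> (2 * pi * B) * norm (x + h - x)"
  proof (rule differentiable_bound[OF convex_closed_segment])
    fix y assume y: "y \<in> closed_segment x (x + h)"
    show "onorm (\<lambda>t. t *\<^sub>R ((2 * pi) *\<^sub>R (\<i> * weyl_sum K y))) \<le> 2 * pi * B"
    proof (rule onorm_le)
      fix t :: real
      have "2 * pi * \<bar>t\<bar> * norm (weyl_sum K y) \<le> 2 * pi * \<bar>t\<bar> * B"
        using B[OF y] by (intro mult_left_mono) auto
      then show "norm (t *\<^sub>R ((2 * pi) *\<^sub>R (\<i> * weyl_sum K y))) \<le> 2 * pi * B * norm t"
        by (simp add: norm_mult abs_mult mult_ac)
    qed
  qed auto
  then show ?thesis by simp
qed

text \<open>Cutting at K = floor(|h|^(-1/2)) balances the two parts: A K^(1+e) |h| from the low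
  frequencies and A K^(e-1) from the tail are both of order A |h|^((1-e)/2). The condition on
  \<open>k\<close> in the hypothesis amounts to k >= K.\<close>

lemma gauss_series_increment:
  fixes e A h :: real
  assumes e: "0 < e" "e < 1" and A: "0 \<le> A" and h: "h \<noteq> 0" "\<bar>h\<bar> \<le> 1"
    and S: "\<And>k y. \<bar>h\<bar> powr (-1/2) < real (Suc k) \<Longrightarrow> \<bar>y - x\<bar> \<le> \<bar>h\<bar> \<Longrightarrow>
        norm (weyl_sum k y) \<le> A * real k powr (1 + e)"
  shows "norm (gauss_series (x + h) - gauss_series x) \<le> (30 / (1 - e)) * A * \<bar>h\<bar> powr ((1 - e) / 2)"
proof -
  define H where "H = \<bar>h\<bar> powr (-1/2)"
  define K where "K = nat \<lfloor>H\<rfloor>"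
  have H1: "1 \<le> H"
    using h powr_mono2'[of "-1/2" "\<bar>h\<bar>" 1] by (simp add: H_def)
  have K: "0 < K" "real K \<le> H" "H < real (Suc K)" using H1 unfolding K_def by linarith+
  have K2: "H / 2 \<le> real K" using K by simp
  have S': "norm (weyl_sum k y) \<le> A * real k powr (1 + e)" if "K \<le> k" "\<bar>y - x\<bar> \<le> \<bar>h\<bar>" for k y
    using S[of k y] that K by (simp add: H_def)
  define w where "w = A * \<bar>h\<bar> powr ((1 - e) / 2)"
  define P where "P y = (\<Sum>k=1..K. cis (2 * pi * (real k)\<^sup>2 * y) / (of_nat k)\<^sup>2)" for y
  have tail: "norm (gauss_series y - P y) \<le> (8 / (1 - e)) * w" if "\<bar>y - x\<bar> \<le> \<bar>h\<bar>" for y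
  proof -
    have "norm (gauss_series y - P y) \<le> (4 / (1 - e)) * A * real K powr (e - 1)"
      unfolding P_def by (rule gauss_series_tail_bound[OF e K(1) A]) (use S' that in auto)
    \<comment> \<open>Replacing K by H costs the factor 2^(1-e) <= 2, because K >= H/2.\<close>
    also have "\<dots> \<le> (4 / (1 - e)) * A * (2 * \<bar>h\<bar> powr ((1 - e) / 2))"
    proof (intro mult_left_mono)
      have "real K powr (e - 1) \<le> (H / 2) powr (e - 1)"
        using K2 H1 e by (intro powr_mono2') auto
      also have "\<dots> = H powr (e - 1) * 2 powr (1 - e)"
        using powr_minus_divide[of 2 "e - 1"] H1 by (simp add: powr_divide)
      also have "\<dots> \<le> H powr (e - 1) * 2 powr 1"
        using e by (intro mult_left_mono powr_mono) auto
      also have "H powr (e - 1) = \<bar>h\<bar> powr ((1 - e) / 2)"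
        unfolding H_def powr_powr by (rule arg_cong[of _ _ "\<lambda>t. \<bar>h\<bar> powr t"]) (simp add: field_simps)
      finally show "real K powr (e - 1) \<le> 2 * \<bar>h\<bar> powr ((1 - e) / 2)" by simp
    qed (use e A in auto)
    finally show ?thesis by (simp add: w_def mult_ac)
  qed
  have low: "norm (P (x + h) - P x) \<le> 8 * w"
  proof -
    have "norm (P (x + h) - P x) \<le> 2 * pi * (A * real K powr (1 + e)) * \<bar>h\<bar>"
      unfolding P_def
    proof (rule gauss_partial_sum_diff)
      fix y assume "y \<in> closed_segment x (x + h)"
      then have "\<bar>y - x\<bar> \<le> \<bar>h\<bar>" by (auto simp: closed_segment_eq_real_ivl split: if_splits)
      then show "norm (weyl_sum K y) \<le> A * real K powr (1 + e)" by (rule S'[OF order_refl])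
    qed
    also have "\<dots> \<le> 2 * 4 * (A * H powr (1 + e)) * \<bar>h\<bar>"
      using A K e pi_less_4 by (intro mult_mono powr_mono2) auto
    also have "\<dots> = 8 * (A * (H powr (1 + e) * \<bar>h\<bar>))" by simp
    also have "H powr (1 + e) * \<bar>h\<bar> = \<bar>h\<bar> powr ((1 - e) / 2)"
    proof -
      have "H powr (1 + e) * \<bar>h\<bar> = \<bar>h\<bar> powr (-1/2 * (1 + e)) * \<bar>h\<bar> powr 1"
        using h by (simp add: H_def powr_powr)
      also have "\<dots> = \<bar>h\<bar> powr ((1 - e) / 2)"
        unfolding powr_add[symmetric] by (simp add: field_simps)
      finally show ?thesis .
    qed
    finally show ?thesis by (simp add: w_def)
  qed
  have "norm (gauss_series (x + h) - gauss_series x)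
      = norm ((gauss_series (x + h) - P (x + h)) + (P (x + h) - P x) - (gauss_series x - P x))"
    by simp
  also have "\<dots> \<le> (8 / (1 - e)) * w + 8 * w + (8 / (1 - e)) * w"
    by (intro norm_triangle_le_diff norm_triangle_le add_mono tail low) auto
  also have "\<dots> \<le> (30 / (1 - e)) * w"
  proof -
    have w: "0 \<le> w" using A by (simp add: w_def)
    then have "w \<le> w / (1 - e)" using e by (simp add: field_simps)
    then have "8 * (w / (1 - e)) + 8 * w + 8 * (w / (1 - e)) \<le> 30 * (w / (1 - e))"
      using w e by linarith
    then show ?thesis by simp
  qed
  finally show ?thesis by (simp add: w_def mult_ac)
qed

section \<open>Increments at rationals and at badly approximable points\<close>

lemma Dirichlet_approx_nat:
  fixes y :: real
  assumes "0 < n"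
  obtains p :: int and q :: nat where "coprime p (int q)" "0 < q" "q \<le> n"
    "\<bar>y - of_int p / real q\<bar> \<le> 1 / (real q * real n)"
proof -
  obtain p q' where pq: "coprime p q'" "0 < q'" "q' \<le> int n" "\<bar>of_int q' * y - of_int p\<bar> < 1 / real n"
    using Dirichlet_approx_coprime[OF assms, of y] by metis
  define q where "q = nat q'"
  have q: "q' = int q" "0 < q" using pq by (auto simp: q_def)
  have "y - of_int p / real q = (of_int q' * y - of_int p) / real q" using q by (simp add: field_simps)
  then have "\<bar>y - of_int p / real q\<bar> = \<bar>of_int q' * y - of_int p\<bar> / real q" by (simp add: abs_divide)
  also have "\<dots> \<le> (1 / real n) / real q" using pq(4) by (intro divide_right_mono) auto
  finally have "\<bar>y - of_int p / real q\<bar> \<le> 1 / (real q * real n)" by (simp add: mult.commute)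
  then show ?thesis using that[of p q] pq q by simp
qed

text \<open>The inequality ln k <= k^(2e)/(2e) trades the logarithm for k^(2e), whose square root is
  the loss k^e. The constant 145 is that of the two Weyl bounds.\<close>

lemma norm_le_of_square_log_bound:
  fixes z :: complex
  assumes e: "0 < e" and k: "0 < k" and a: "0 \<le> a"
    and z: "(norm z)\<^sup>2 \<le> 145 * (1 + ln (real k)) * (a * (real k)\<^sup>2)"
  shows "norm z \<le> sqrt (145 * (1 + 1 / (2 * e)) * a) * real k powr (1 + e)"
proof -
  have "ln (real k) \<le> real k powr (2 * e) / (2 * e)" using e k by (intro ln_powr_bound) auto
  moreover have "1 \<le> real k powr (2 * e)" using e k by (intro ge_one_powr_ge_zero) auto
  ultimately have L: "1 + ln (real k) \<le> (1 + 1 / (2 * e)) * real k powr (2 * e)" by (simp add: algebra_simps)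
  have "(norm z)\<^sup>2 \<le> 145 * ((1 + 1 / (2 * e)) * real k powr (2 * e)) * (a * (real k)\<^sup>2)"
    using z by (rule order_trans) (intro mult_right_mono mult_left_mono L, use a in auto)
  also have "\<dots> = (145 * (1 + 1 / (2 * e)) * a) * (real k powr (2 * e) * (real k)\<^sup>2)" by simp
  also have "real k powr (2 * e) * (real k)\<^sup>2 = (real k powr (1 + e))\<^sup>2"
    using k by (simp add: powr_add power_mult_distrib powr_power mult.commute)
  also have "(145 * (1 + 1 / (2 * e)) * a) * (real k powr (1 + e))\<^sup>2
      = (sqrt (145 * (1 + 1 / (2 * e)) * a) * real k powr (1 + e))\<^sup>2"
    using a e by (simp add: power_mult_distrib)
  finally show ?thesis by (rule power2_le_imp_le) (use a e in auto)
qed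

text \<open>Only k with |h|^(-1/2) < k + 1 matter, and |h| <= q^(-2) makes these at least q. For
  such k the bound k + k^2/q' is of order at most k^2/q once q' is bounded below by a multiple of q,
  so that |S_k| gains the factor q^(-1/2).\<close>

lemma gauss_series_near_rational:
  fixes p :: int and e h :: real
  assumes e: "0 < e" "e < 1" and cop: "coprime p (int q)" and q: "0 < q"
    and h: "h \<noteq> 0" "\<bar>h\<bar> \<le> 1 / (real q)\<^sup>2"
  shows "norm (gauss_series (of_int p / real q + h) - gauss_series (of_int p / real q))
    \<le> (30 / (1 - e)) * sqrt (145 * (1 + 1 / (2 * e)) * (3 / real q)) * \<bar>h\<bar> powr ((1 - e) / 2)"
proof (rule gauss_series_increment[OF e])
  have "1 / (real q)\<^sup>2 \<le> 1" using q by simp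
  then show "\<bar>h\<bar> \<le> 1" using h by linarith
next
  fix k y assume k: "\<bar>h\<bar> powr (-1/2) < real (Suc k)" and y: "\<bar>y - of_int p / real q\<bar> \<le> \<bar>h\<bar>"
  have "(1 / (real q)\<^sup>2) powr (-1/2) \<le> \<bar>h\<bar> powr (-1/2)" using h by (intro powr_mono2') auto
  moreover have "(1 / (real q)\<^sup>2) powr (-1/2) = real q"
    using q by (simp add: powr_minus_divide powr_half_sqrt real_sqrt_divide)
  ultimately have "q \<le> k" using k by simp
  then have k0: "0 < k" "real q \<le> real k" using q by auto
  obtain p' q' where pq': "coprime p' (int q')" "0 < q'" "q' \<le> 4 * k"
    "\<bar>y - of_int p' / real q'\<bar> \<le> 1 / (real q' * real (4 * k))"
    using Dirichlet_approx_nat[of "4 * k" y] k0 by auto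
  \<comment> \<open>The Dirichlet approximant \<open>p'/q'\<close> of \<open>y\<close> is \<open>p/q\<close> itself or, being distinct from it but close, has a
    comparably large denominator.\<close>
  have inv: "1 / real q' \<le> (4/3) * (1 / real q)"
  proof (cases "p * int q' = p' * int q")
    case True
    then have "int q dvd p * int q'" by simp
    then have "q dvd q'" using cop by (simp add: coprime_dvd_mult_right_iff coprime_commute)
    then have "q \<le> q'" using pq'(2) by (rule dvd_imp_le)
    then have "1 / real q' \<le> 1 / real q" using q by (intro divide_left_mono) auto
    moreover have "0 \<le> 1 / real q" by simp
    ultimately show ?thesis by linarith
  next
    case False
    then have "1 \<le> \<bar>p * int q' - p' * int q\<bar>" by linarith
    then have "real_of_int 1 \<le> of_int \<bar>p * int q' - p' * int q\<bar>" by (simp only: of_int_le_iff)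
    then have "1 \<le> \<bar>of_int p * real q' - of_int p' * real q\<bar>" by simp
    then have "1 / (real q * real q') \<le> \<bar>of_int p * real q' - of_int p' * real q\<bar> / (real q * real q')"
      by (intro divide_right_mono) auto
    also have "\<dots> = \<bar>of_int p / real q - of_int p' / real q'\<bar>"
    proof -
      have "of_int p / real q - of_int p' / real q' = (of_int p * real q' - of_int p' * real q) / (real q * real q')"
        using q pq'(2) by (simp add: field_simps)
      then show ?thesis by (simp add: abs_divide)
    qed
    also have "\<dots> \<le> \<bar>y - of_int p / real q\<bar> + \<bar>y - of_int p' / real q'\<bar>" by linarith
    also have "\<dots> \<le> 1 / (real q)\<^sup>2 + 1 / (real q' * real (4 * k))" using y h pq'(4) by linarith
    \<comment> \<open>As k >= q, this error is at most a quarter of 1/(q q'), the lower bound for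
      the gap between the two fractions; comparing the remaining three quarters with 1/q^2 gives the
      factor 4/3.\<close>
    also have "1 / (real q' * real (4 * k)) \<le> 1 / (4 * (real q * real q'))"
      using q pq'(2) k0 by (intro divide_left_mono) (auto simp: mult_ac)
    finally have "(3/4) * (1 / (real q * real q')) \<le> 1 / (real q)\<^sup>2" by simp
    then show ?thesis using q pq'(2) by (simp add: field_simps power2_eq_square)
  qed
  have "(norm (weyl_sum k y))\<^sup>2 \<le> 145 * (1 + ln (real k)) * (real k + (real k)\<^sup>2 / real q')"
    by (rule weyl_sum_bound_denominator[OF pq'(1-3) k0(1)]) (use pq'(4) in \<open>simp add: mult_ac\<close>)
  also have "\<dots> \<le> 145 * (1 + ln (real k)) * (3 / real q * (real k)\<^sup>2)"
  proof (intro mult_left_mono)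
    \<comment> \<open>The linear term is at most k^2/q because q <= k, and 1 + 4/3 <= 3.\<close>
    have "real k * real q \<le> real k * real k" using k0 by (intro mult_left_mono) auto
    then have "real k \<le> (real k)\<^sup>2 * (1 / real q)" using q by (simp add: field_simps power2_eq_square)
    moreover have "(real k)\<^sup>2 * (1 / real q') \<le> (real k)\<^sup>2 * ((4/3) * (1 / real q))"
      using inv by (intro mult_left_mono) auto
    moreover have "0 \<le> (real k)\<^sup>2 * (1 / real q)" by simp
    ultimately have "real k + (real k)\<^sup>2 * (1 / real q') \<le> 3 * ((real k)\<^sup>2 * (1 / real q))" by linarith
    then show "real k + (real k)\<^sup>2 / real q' \<le> 3 / real q * (real k)\<^sup>2" by simp
  qed (use k0 in auto)
  finally show "norm (weyl_sum k y) \<le> sqrt (145 * (1 + 1 / (2 * e)) * (3 / real q)) * real k powr (1 + e)"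
    by (intro norm_le_of_square_log_bound e k0) auto
qed (use h e in auto)

text \<open>For all relevant k and all y within |h| of x, |S_k(y)|^2 is at most a constant times
  |h|^(1/\<mu>) k^(2+2e). The square root of the first factor is the gain |h|^(1/(2\<mu>)) over the
  exponent (1-e)/2.\<close>

lemma gauss_series_badly_approximable:
  fixes e h c \<mu> x :: real
  assumes e: "0 < e" "e < 1" and \<mu>: "2 \<le> \<mu>" and c: "0 < c"
    and x: "\<And>p q. coprime p (int q) \<Longrightarrow> 0 < q \<Longrightarrow> c * real q powr (-\<mu>) \<le> \<bar>x - of_int p / real q\<bar>"
    and h: "h \<noteq> 0" "\<bar>h\<bar> \<le> 1"
  shows "norm (gauss_series (x + h) - gauss_series x)
    \<le> (30 / (1 - e)) * sqrt (145 * (1 + 1 / (2 * e)) * (8 + (2 / c) powr (1 / \<mu>) + 8 / c))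
        * \<bar>h\<bar> powr (1/2 + 1 / (2 * \<mu>) - e / 2)"
proof -
  define b where "b = 1 / \<mu>"
  have b: "0 < b" "2 * b \<le> 1" "\<mu> * b = 1" using \<mu> by (auto simp: b_def field_simps)
  \<comment> \<open>\<open>M\<close> is at least the constant of each of the three cases below: 4
    for the linear term of the Weyl bound, plus 4, (2/c)^b or 8/c for the second term.\<close>
  define M where "M = 8 + (2 / c) powr b + 8 / c"
  have M: "8 \<le> M" "4 + (2 / c) powr b \<le> M" "4 + 8 / c \<le> M" using c by (auto simp: M_def)
  define w where "w = \<bar>h\<bar> powr b"
  have w: "0 < w" using h by (simp add: w_def)
  have "norm (gauss_series (x + h) - gauss_series x)
    \<le> (30 / (1 - e)) * sqrt (145 * (1 + 1 / (2 * e)) * (M * w)) * \<bar>h\<bar> powr ((1 - e) / 2)"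
  proof (rule gauss_series_increment[OF e _ h])
    fix k y assume k: "\<bar>h\<bar> powr (-1/2) < real (Suc k)" and y: "\<bar>y - x\<bar> \<le> \<bar>h\<bar>"
    have "1 \<le> \<bar>h\<bar> powr (-1/2)" using h powr_mono2'[of "-1/2" "\<bar>h\<bar>" 1] by simp
    with k have k0: "0 < k" by (cases k) auto
    \<comment> \<open>As 2k >= |h|^(-1/2), the saving k^(-2b) can be traded for w = |h|^b; the
      factor 2^(2b) is at most 4.\<close>
    have kb: "real k powr (- 2 * b) \<le> 4 * w"
    proof -
      have "\<bar>h\<bar> powr (-1/2) \<le> 2 * real k" using k k0 by simp
      then have "(2 * real k) powr (- 2 * b) \<le> (\<bar>h\<bar> powr (-1/2)) powr (- 2 * b)"
        using b h by (intro powr_mono2') auto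
      also have "\<dots> = w" by (simp add: powr_powr w_def)
      finally have "2 powr (- 2 * b) * real k powr (- 2 * b) \<le> w" by (simp add: powr_mult)
      moreover have "2 powr (-2) \<le> 2 powr (- 2 * b)" using b by (intro powr_mono) auto
      then have "1/4 * real k powr (- 2 * b) \<le> 2 powr (- 2 * b) * real k powr (- 2 * b)"
        by (intro mult_right_mono) (auto simp: powr_minus_divide)
      ultimately show ?thesis by linarith
    qed
    \<comment> \<open>Relative to k^2 the linear term is 1/k, which is at most k^(-2b) because 2b <=
      1, that is, \<mu> >= 2.\<close>
    have k1: "real k \<le> (4 * w) * (real k)\<^sup>2"
    proof -
      have "real k powr (-1) \<le> real k powr (- 2 * b)" using k0 b by (intro powr_mono) auto
      then have "real k powr (-1) * (real k)\<^sup>2 \<le> (4 * w) * (real k)\<^sup>2"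
        using kb by (intro mult_right_mono) auto
      then show ?thesis using k0 by (simp add: powr_minus_divide power2_eq_square)
    qed
    obtain p q where pq: "coprime p (int q)" "0 < q" "q \<le> 4 * k"
      "\<bar>y - of_int p / real q\<bar> \<le> 1 / (real q * real (4 * k))"
      using Dirichlet_approx_nat[of "4 * k" y] k0 by auto
    have \<delta>: "\<bar>y - of_int p / real q\<bar> \<le> 1 / (4 * real q * real k)" using pq(4) by (simp add: mult_ac)
    define d where "d = (c / 2) * real q powr (-\<mu>)"
    have d: "0 < d" using c pq by (simp add: d_def)
    have q1: "(real q powr (-\<mu>)) powr b = 1 / real q"
      unfolding powr_powr using b(3) pq(2) by (simp add: powr_neg_one)
    \<comment> \<open>Shared by the two cases in which 1/q is at most a constant times
      \<open>w\<close>.\<close>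
    have denom: "(norm (weyl_sum k y))\<^sup>2 \<le> 145 * (1 + ln (real k)) * ((M * w) * (real k)\<^sup>2)"
      if "1 / real q \<le> A * w" "4 + A \<le> M" for A
    proof -
      have "(norm (weyl_sum k y))\<^sup>2 \<le> 145 * (1 + ln (real k)) * (real k + (real k)\<^sup>2 / real q)"
        by (rule weyl_sum_bound_denominator[OF pq(1-3) k0 \<delta>])
      also have "\<dots> \<le> 145 * (1 + ln (real k)) * ((M * w) * (real k)\<^sup>2)"
      proof (intro mult_left_mono)
        have "(real k)\<^sup>2 * (1 / real q) \<le> (real k)\<^sup>2 * (A * w)" using that by (intro mult_left_mono) auto
        then have "real k + (real k)\<^sup>2 / real q \<le> (4 + A) * (w * (real k)\<^sup>2)"
          using k1 by (simp add: algebra_simps)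
        also have "\<dots> \<le> M * (w * (real k)\<^sup>2)" using that w by (intro mult_right_mono) auto
        finally show "real k + (real k)\<^sup>2 / real q \<le> (M * w) * (real k)\<^sup>2" by simp
      qed (use k0 in auto)
      finally show ?thesis .
    qed
    \<comment> \<open>The hypothesis keeps \<open>x\<close> away from \<open>p/q\<close>: either \<open>h\<close> is large enough to bridge that distance, which bounds
      \<open>q\<close> from below, or \<open>y\<close> is away from \<open>p/q\<close> as well. In the latter case the two Weyl bounds balance
      at \<open>q = k\<^bsup>2/\<mu>\<^esup>\<close>.\<close>
    have "(norm (weyl_sum k y))\<^sup>2 \<le> 145 * (1 + ln (real k)) * ((M * w) * (real k)\<^sup>2)"
    proof (cases "d \<le> \<bar>h\<bar>")
      case True
      then have "real q powr (-\<mu>) \<le> (2 / c) * \<bar>h\<bar>" using c by (simp add: d_def field_simps)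
      then have "(real q powr (-\<mu>)) powr b \<le> ((2 / c) * \<bar>h\<bar>) powr b" using b by (intro powr_mono2) auto
      then have "1 / real q \<le> (2 / c) powr b * w" by (simp only: q1 w_def powr_mult)
      then show ?thesis using M by (intro denom[of "(2 / c) powr b"]) auto
    next
      case False
      have "2 * d \<le> \<bar>x - of_int p / real q\<bar>" using x[OF pq(1,2)] by (simp add: d_def)
      also have "\<dots> \<le> \<bar>y - of_int p / real q\<bar> + \<bar>y - x\<bar>" by linarith
      finally have dy: "d \<le> \<bar>y - of_int p / real q\<bar>" using y False by linarith
      show ?thesis
      proof (cases "real k powr (2 * b) \<le> real q")
        case True
        then have "1 / real q \<le> 1 / real k powr (2 * b)"
          using k0 pq(2) by (intro divide_left_mono mult_pos_pos) auto
        also have "\<dots> = real k powr (- 2 * b)" by (simp add: powr_minus_divide)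
        also note kb
        finally show ?thesis using M by (intro denom[of 4]) auto
      next
        case q2: False
        have "(norm (weyl_sum k y))\<^sup>2
            \<le> 145 * (1 + ln (real k)) * (real k + 1 / (real q * \<bar>y - of_int p / real q\<bar>))"
          by (rule weyl_sum_bound_distance[OF pq(1-3) k0 \<delta>]) (use dy d in auto)
        also have "\<dots> \<le> 145 * (1 + ln (real k)) * ((M * w) * (real k)\<^sup>2)"
        proof (intro mult_left_mono)
          have "1 / (real q * \<bar>y - of_int p / real q\<bar>) \<le> 1 / (real q * d)"
            using d dy pq(2) by (intro divide_left_mono mult_left_mono mult_pos_pos) auto
          also have "\<dots> = (2 / c) * real q powr (\<mu> - 1)"
            using pq(2) c by (simp add: d_def powr_diff powr_minus_divide)
          also have "real q powr (\<mu> - 1) \<le> (real k powr (2 * b)) powr (\<mu> - 1)"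
            using q2 \<mu> by (intro powr_mono2) auto
          \<comment> \<open>The exponent is 2b(\<mu> - 1) = 2 - 2b since b \<mu> = 1, so the saving
            k^(-2b) is the same as for large q.\<close>
          also have "\<dots> = real k powr (2 + - 2 * b)"
            unfolding powr_powr using b(3) by (intro arg_cong[of _ _ "\<lambda>t. real k powr t"]) (simp add: algebra_simps)
          also have "\<dots> = (real k)\<^sup>2 * real k powr (- 2 * b)"
            unfolding powr_add using k0 by simp
          also have "\<dots> \<le> (real k)\<^sup>2 * (4 * w)" using kb by (intro mult_left_mono) auto
          finally have "1 / (real q * \<bar>y - of_int p / real q\<bar>) \<le> (2 / c) * ((real k)\<^sup>2 * (4 * w))"
            using c by (simp add: divide_right_mono)
          then have "real k + 1 / (real q * \<bar>y - of_int p / real q\<bar>) \<le> (4 + 8 / c) * (w * (real k)\<^sup>2)"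
            using k1 by (simp add: algebra_simps)
          also have "\<dots> \<le> M * (w * (real k)\<^sup>2)" using M w by (intro mult_right_mono) auto
          finally show "real k + 1 / (real q * \<bar>y - of_int p / real q\<bar>) \<le> (M * w) * (real k)\<^sup>2" by simp
        qed (use k0 in auto)
        finally show ?thesis .
      qed
    qed
    then show "norm (weyl_sum k y) \<le> sqrt (145 * (1 + 1 / (2 * e)) * (M * w)) * real k powr (1 + e)"
      using M w by (intro norm_le_of_square_log_bound e k0) auto
  qed (use M w e in auto)
  also have "sqrt (145 * (1 + 1 / (2 * e)) * (M * w)) = sqrt (145 * (1 + 1 / (2 * e)) * M) * sqrt w"
    by (simp add: real_sqrt_mult)
  also have "sqrt w = \<bar>h\<bar> powr (b / 2)"
    by (simp add: w_def powr_half_sqrt[symmetric] powr_powr)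
  also have "(30 / (1 - e)) * (sqrt (145 * (1 + 1 / (2 * e)) * M) * \<bar>h\<bar> powr (b / 2)) * \<bar>h\<bar> powr ((1 - e) / 2)
      = (30 / (1 - e)) * sqrt (145 * (1 + 1 / (2 * e)) * M) * (\<bar>h\<bar> powr (b / 2) * \<bar>h\<bar> powr ((1 - e) / 2))"
    by simp
  also have "\<bar>h\<bar> powr (b / 2) * \<bar>h\<bar> powr ((1 - e) / 2) = \<bar>h\<bar> powr (1/2 + 1 / (2 * \<mu>) - e / 2)"
    unfolding powr_add[symmetric] by (intro arg_cong[of _ _ "\<lambda>t. \<bar>h\<bar> powr t"]) (simp add: b_def field_simps)
  finally show ?thesis by (simp add: M_def b_def)
qed

section \<open>Hausdorff content\<close>

text \<open>Without a bound on the diameters, subadditivity and covering estimates need no control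
  of scales; for s > 0, \<open>hausdorff_measure_eq_0\<close> transfers null sets back to the
  measure.\<close>

definition hausdorff_content :: "real \<Rightarrow> 'a::metric_space set \<Rightarrow> ennreal" where
  "hausdorff_content s A =
     (INF U \<in> {U :: nat \<Rightarrow> 'a set. (\<forall>i. bounded (U i)) \<and> A \<subseteq> (\<Union>i. U i)}.
        (\<Sum>i. hausdorff_content_term s (U i)))"

lemma hausdorff_content_le:
  assumes "\<And>i. bounded (U i)" "A \<subseteq> (\<Union>i. U i)"
  shows "hausdorff_content s A \<le> (\<Sum>i. hausdorff_content_term s (U i))"
  unfolding hausdorff_content_def using assms by (intro INF_lower) auto

lemma hausdorff_content_close:
  assumes "hausdorff_content s A < e"
  shows "\<exists>U. (\<forall>i. bounded (U i)) \<and> A \<subseteq> (\<Union>i. U i) \<and> (\<Sum>i. hausdorff_content_term s (U i)) < e"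
  using assms unfolding hausdorff_content_def INF_less_iff by auto

lemma hausdorff_content_mono:
  assumes "A \<subseteq> B"
  shows "hausdorff_content s A \<le> hausdorff_content s B"
  unfolding hausdorff_content_def using assms by (intro INF_superset_mono) auto

text \<open>Covers of the \<open>A n\<close> that are optimal up to e/2^(n+1) are merged into one
  sequence along \<open>prod_decode\<close>.\<close>

lemma hausdorff_content_countable_subadditive:
  fixes A :: "nat \<Rightarrow> 'a::metric_space set"
  shows "hausdorff_content s (\<Union>n. A n) \<le> (\<Sum>n. hausdorff_content s (A n))"
proof (rule ennreal_le_epsilon)
  fix e :: real assume e: "0 < e" and fin: "(\<Sum>n. hausdorff_content s (A n)) < top"
  define r where "r n = e * (1/2) ^ Suc n" for n
  have r: "0 < r n" for n using e by (simp add: r_def)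
  have "\<exists>U. (\<forall>i. bounded (U i)) \<and> A n \<subseteq> (\<Union>i. U i) \<and>
      (\<Sum>i. hausdorff_content_term s (U i)) < hausdorff_content s (A n) + ennreal (r n)" for n
  proof (rule hausdorff_content_close)
    have "hausdorff_content s (A n) < top" using fin by (rule ennreal_suminf_lessD)
    then show "hausdorff_content s (A n) < hausdorff_content s (A n) + ennreal (r n)"
      using r[of n] by (simp add: less_top)
  qed
  then obtain U where U: "\<And>n i. bounded (U n i)" "\<And>n. A n \<subseteq> (\<Union>i. U n i)"
    "\<And>n. (\<Sum>i. hausdorff_content_term s (U n i)) < hausdorff_content s (A n) + ennreal (r n)"
    by metis
  define V where "V k = U (fst (prod_decode k)) (snd (prod_decode k))" for k
  have "(\<Union>n. A n) \<subseteq> (\<Union>k. V k)"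
  proof
    fix a assume "a \<in> (\<Union>n. A n)"
    then obtain n i where "a \<in> U n i" using U(2) by blast
    then have "a \<in> V (prod_encode (n, i))" by (simp add: V_def)
    then show "a \<in> (\<Union>k. V k)" by blast
  qed
  then have "hausdorff_content s (\<Union>n. A n) \<le> (\<Sum>k. hausdorff_content_term s (V k))"
    by (intro hausdorff_content_le) (simp_all add: V_def U(1))
  also have "\<dots> = (\<Sum>n. \<Sum>i. hausdorff_content_term s (U n i))"
    unfolding V_def
    by (rule suminf_ennreal_2dimen[where f = "\<lambda>p. hausdorff_content_term s (U (fst p) (snd p))"]) simp
  also have "\<dots> \<le> (\<Sum>n. hausdorff_content s (A n) + ennreal (r n))"
    using U(3) by (intro suminf_le less_imp_le) auto
  also have "\<dots> = (\<Sum>n. hausdorff_content s (A n)) + (\<Sum>n. ennreal (r n))"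
    by (rule suminf_add[symmetric]) auto
  also have "(\<Sum>n. ennreal (r n)) = ennreal e"
    using sums_mult[OF power_half_series, of e] r by (intro suminf_ennreal_eq) (auto simp: r_def less_imp_le)
  finally show "hausdorff_content s (\<Union>n. A n) \<le> (\<Sum>n. hausdorff_content s (A n)) + ennreal e" .
qed

lemma hausdorff_content_le_diameter:
  fixes U :: "'a::metric_space set"
  assumes "0 < s" "bounded U"
  shows "hausdorff_content s U \<le> ennreal (diameter U powr s)"
proof -
  define V where "V i = (if i = 0 then U else {})" for i :: nat
  have "hausdorff_content s U \<le> (\<Sum>i. hausdorff_content_term s (V i))"
    by (rule hausdorff_content_le) (use assms in \<open>auto simp: V_def\<close>)
  also have "\<dots> = (\<Sum>i\<in>{0}. hausdorff_content_term s (V i))"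
    by (rule suminf_finite) (auto simp: V_def hausdorff_content_term_def)
  also have "\<dots> \<le> ennreal (diameter U powr s)"
    using assms by (auto simp: V_def hausdorff_content_term_def)
  finally show ?thesis .
qed

lemma hausdorff_content_finite_Union:
  fixes V :: "nat \<Rightarrow> 'a::metric_space set"
  assumes s: "0 < s" and "\<And>i. i < n \<Longrightarrow> hausdorff_content s (V i) \<le> ennreal b" and b: "0 \<le> b"
  shows "hausdorff_content s (\<Union>i<n. V i) \<le> ennreal (real n * b)"
proof -
  define W where "W i = (if i < n then V i else {})" for i
  have e: "hausdorff_content s ({} :: 'a set) = 0"
    using hausdorff_content_le_diameter[OF s, of "{}"] by simp
  have "(\<Union>i<n. V i) \<subseteq> (\<Union>i. W i)" by (auto simp: W_def)
  then have "hausdorff_content s (\<Union>i<n. V i) \<le> hausdorff_content s (\<Union>i. W i)"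
    by (rule hausdorff_content_mono)
  also have "\<dots> \<le> (\<Sum>i. hausdorff_content s (W i))" by (rule hausdorff_content_countable_subadditive)
  also have "\<dots> = (\<Sum>i<n. hausdorff_content s (W i))"
    by (rule suminf_finite) (auto simp: W_def e)
  also have "\<dots> \<le> (\<Sum>i<n. ennreal b)"
    using assms by (intro sum_mono) (auto simp: W_def)
  also have "\<dots> = ennreal (real n * b)" using b by (simp add: ennreal_mult ennreal_of_nat_eq_real_of_nat)
  finally show ?thesis .
qed

text \<open>A Borel-Cantelli argument: the levels q > Q alone cover \<open>A\<close>, at a cost
  bounded by the tail of the convergent series.\<close>

lemma hausdorff_content_limsup_eq_0:
  fixes V :: "nat \<Rightarrow> nat \<Rightarrow> 'a::metric_space set" and D :: "nat \<Rightarrow> real"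
  assumes s: "0 < s"
    and V: "\<And>q i. 0 < q \<Longrightarrow> bounded (V q i)" "\<And>q i. 0 < q \<Longrightarrow> diameter (V q i) \<le> D q"
    and sum: "summable (\<lambda>q. real (N q) * D q powr s)"
    and A: "\<And>Q. A \<subseteq> (\<Union>q\<in>{Q<..}. \<Union>i<N q. V q i)"
  shows "hausdorff_content s A = 0"
proof -
  have "hausdorff_content s A \<le> 0 + ennreal e" if e: "0 < e" for e
  proof -
    define f where "f q = real (N q) * D q powr s" for q
    obtain Q where "\<forall>n\<ge>Q. norm (\<Sum>i. f (i + n)) < e"
      using suminf_exist_split[OF e sum[folded f_def]] by blast
    \<comment> \<open>The shift is \<open>Suc Q\<close> because the covers consist of levels
      strictly above \<open>Q\<close>.\<close>
    then have Q: "norm (\<Sum>i. f (i + Suc Q)) < e" by (rule allE[where x = "Suc Q"]) simp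
    define W where "W j = (\<Union>i<N (j + Suc Q). V (j + Suc Q) i)" for j
    have W: "hausdorff_content s (W j) \<le> ennreal (f (j + Suc Q))" for j
      unfolding W_def f_def
    proof (rule hausdorff_content_finite_Union[OF s])
      fix i
      have "hausdorff_content s (V (j + Suc Q) i) \<le> ennreal (diameter (V (j + Suc Q) i) powr s)"
        by (rule hausdorff_content_le_diameter[OF s V(1)]) simp
      also have "\<dots> \<le> ennreal (D (j + Suc Q) powr s)"
        using s V by (intro ennreal_leI powr_mono2 diameter_ge_0) auto
      finally show "hausdorff_content s (V (j + Suc Q) i) \<le> ennreal (D (j + Suc Q) powr s)" .
    qed simp
    have sm: "summable (\<lambda>j. f (j + Suc Q))" using sum[folded f_def] by (rule summable_ignore_initial_segment)
    have "A \<subseteq> (\<Union>j. W j)"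
    proof
      fix a assume "a \<in> A"
      then obtain q i where q: "Q < q" "i < N q" "a \<in> V q i" using A[of Q] by auto
      then have "a \<in> W (q - Suc Q)" by (auto simp: W_def)
      then show "a \<in> (\<Union>j. W j)" by blast
    qed
    then have "hausdorff_content s A \<le> hausdorff_content s (\<Union>j. W j)" by (rule hausdorff_content_mono)
    also have "\<dots> \<le> (\<Sum>j. hausdorff_content s (W j))" by (rule hausdorff_content_countable_subadditive)
    also have "\<dots> \<le> (\<Sum>j. ennreal (f (j + Suc Q)))" by (intro suminf_le W) auto
    also have "\<dots> = ennreal (\<Sum>j. f (j + Suc Q))"
      by (rule suminf_ennreal2[OF _ sm]) (simp add: f_def)
    also have "\<dots> \<le> ennreal e" using Q by (intro ennreal_leI) auto
    finally show ?thesis by simp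
  qed
  then have "hausdorff_content s A \<le> 0" by (rule ennreal_le_epsilon)
  then show ?thesis by simp
qed

lemma hausdorff_content_countable_Union_eq_0:
  fixes A :: "nat \<Rightarrow> 'a::metric_space set"
  assumes "\<And>i. hausdorff_content s (A i) = 0"
  shows "hausdorff_content s (\<Union>i. A i) = 0"
  using hausdorff_content_countable_subadditive[of s A] assms by simp

lemma hausdorff_content_countable_eq_0:
  fixes A :: "'a::metric_space set"
  assumes "0 < s" "countable A"
  shows "hausdorff_content s A = 0"
proof (cases "A = {}")
  case True
  then show ?thesis using hausdorff_content_le_diameter[OF assms(1), of A] by simp
next
  case False
  have "(\<Union>i. {from_nat_into A i}) = A" using range_from_nat_into[OF False assms(2)] by blast
  moreover have "hausdorff_content s {x} = 0" for x :: 'a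
    using hausdorff_content_le_diameter[OF assms(1), of "{x}"] by simp
  ultimately show ?thesis
    using hausdorff_content_countable_Union_eq_0[of s "\<lambda>i. {from_nat_into A i}"] by simp
qed

lemma hausdorff_content_Un_eq_0:
  fixes A B :: "'a::metric_space set"
  assumes "hausdorff_content s A = 0" "hausdorff_content s B = 0"
  shows "hausdorff_content s (A \<union> B) = 0"
proof -
  have "A \<union> B = (\<Union>i::nat. if i = 0 then A else B)" by (auto split: if_splits)
  then show ?thesis using hausdorff_content_countable_Union_eq_0[of s "\<lambda>i. if i = 0 then A else B"] assms by simp
qed

text \<open>A cover of small total \<open>s\<close>-content automatically consists of sets of small diameter.\<close>
lemma hausdorff_measure_eq_0:
  assumes s: "0 < s" and A: "hausdorff_content s A = 0"
  shows "hausdorff_measure s A = 0"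
proof -
  have "hausdorff_pre \<delta> s A = 0" if \<delta>: "0 < \<delta>" for \<delta>
  proof -
    have "hausdorff_pre \<delta> s A \<le> 0 + ennreal e" if e: "0 < e" for e
    proof -
      have "hausdorff_content s A < ennreal (min e (\<delta> powr s))"
        using A e \<delta> by simp
      then obtain U where U: "\<And>i. bounded (U i)" "A \<subseteq> (\<Union>i. U i)"
        "(\<Sum>i. hausdorff_content_term s (U i)) < ennreal (min e (\<delta> powr s))"
        using hausdorff_content_close by metis
      have "diameter (U i) \<le> \<delta>" for i
      proof (cases "U i = {}")
        case False
        have "hausdorff_content_term s (U i) \<le> (\<Sum>i. hausdorff_content_term s (U i))"
          using sum_le_suminf[OF summableI, of "{i}" "\<lambda>i. hausdorff_content_term s (U i)"] by simp
        also note U(3)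
        finally have "ennreal (diameter (U i) powr s) < ennreal (min e (\<delta> powr s))"
          using False s by (simp add: hausdorff_content_term_def)
        then have "diameter (U i) powr s < \<delta> powr s" by (simp add: ennreal_less_iff)
        then show ?thesis using s \<delta> by (smt (verit) powr_mono2)
      qed (use \<delta> in auto)
      then have "hausdorff_pre \<delta> s A \<le> (\<Sum>i. hausdorff_content_term s (U i))"
        unfolding hausdorff_pre_def using U by (intro INF_lower) auto
      also have "\<dots> \<le> ennreal (min e (\<delta> powr s))" using U(3) by simp
      also have "\<dots> \<le> ennreal e" by (intro ennreal_leI) simp
      finally show ?thesis by simp
    qed
    then have "hausdorff_pre \<delta> s A \<le> 0" by (rule ennreal_le_epsilon)
    then show ?thesis by simp
  qed
  then have "hausdorff_measure s A \<le> 0" unfolding hausdorff_measure_def by (intro SUP_least) auto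
  then show ?thesis by simp
qed

lemma hausdorff_dim_mono:
  assumes "A \<subseteq> B"
  shows "hausdorff_dim A \<le> hausdorff_dim B"
proof -
  have "hausdorff_measure s A \<le> hausdorff_measure s B" for s
    unfolding hausdorff_measure_def hausdorff_pre_def using assms
    by (intro SUP_mono' INF_superset_mono) auto
  then have "hausdorff_measure s A = 0" if "hausdorff_measure s B = 0" for s
    using that by (metis le_zero_eq)
  then show ?thesis unfolding hausdorff_dim_def by (intro Inf_superset_mono image_mono) auto
qed

text \<open>Null content is asked for only when s > d, so s is positive even for d = 0, the value
  that occurs at \<alpha> = 1/2; the convention of \<open>hausdorff_content_term\<close> at s = 0 is
  thus avoided.\<close>

lemma hausdorff_dim_le:
  fixes d :: real
  assumes "0 \<le> d" "\<And>s. d < s \<Longrightarrow> hausdorff_content s A = 0"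
  shows "hausdorff_dim A \<le> ereal d"
proof (rule ccontr)
  assume "\<not> hausdorff_dim A \<le> ereal d"
  then obtain s where s: "d < s" "ereal s < hausdorff_dim A"
    using ereal_dense2[of "ereal d" "hausdorff_dim A"] by (auto simp: not_le)
  have "hausdorff_measure s A = 0" using assms s(1) by (intro hausdorff_measure_eq_0) auto
  then have "hausdorff_dim A \<le> ereal s"
    unfolding hausdorff_dim_def using assms s(1) by (intro Inf_lower) auto
  with s(2) show False by simp
qed

section \<open>Images under \<open>\<phi>\<close>\<close>

text \<open>For k > 0 the terms k and -k agree, each being (1 - e(k^2 x))/(4 pi^2 k^2) with x = -2
  pi t; together they give the denominator 2 pi^2.\<close>

lemma phi_eq_gauss_series:
  "phi t = \<i> * of_real t + (gauss_series 0 - gauss_series (- 2 * pi * t)) / of_real (2 * pi\<^sup>2)"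
proof -
  define x where "x = - 2 * pi * t"
  define T where "T n = phi_term (int (Suc n)) t" for n
  have T: "T n = (cis (2 * pi * (real (Suc n))\<^sup>2 * 0) / (of_nat (Suc n))\<^sup>2
      - cis (2 * pi * (real (Suc n))\<^sup>2 * x) / (of_nat (Suc n))\<^sup>2) / of_real (4 * pi\<^sup>2)" for n
  proof -
    have "exp (- 4 * complex_of_real (pi^2) * \<i> * of_int ((int (Suc n))^2) * complex_of_real t)
        = cis (2 * pi * (real (Suc n))\<^sup>2 * x)"
      unfolding cis_conv_exp x_def by (rule arg_cong[of _ _ exp]) (simp add: power2_eq_square algebra_simps)
    moreover have "T n = (exp (- 4 * complex_of_real (pi^2) * \<i> * of_int ((int (Suc n))^2) * complex_of_real t) - 1)
        / (- 4 * complex_of_real (pi^2) * of_int ((int (Suc n))^2))"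
      unfolding T_def phi_term_def by (rule if_not_P) simp
    moreover have "of_int ((int (Suc n))^2) = (of_nat (Suc n) :: complex)\<^sup>2"
      by (simp only: of_int_power of_int_of_nat_eq)
    moreover have "(w - 1) / (- 4 * P * N) = (1 / N - w / N) / (4 * P)" for w P N :: complex
      by (cases "N = 0"; cases "P = 0") (simp_all add: field_simps)
    ultimately show ?thesis by (simp only: mult_zero_right cis_zero of_real_mult of_real_numeral)
  qed
  have sums: "T sums ((gauss_series 0 - gauss_series x) / of_real (4 * pi\<^sup>2))"
    unfolding T gauss_series_def
    by (intro sums_divide sums_diff summable_sums summable_gauss_series)
  \<comment> \<open>\<open>phi\<close> is an unordered sum over the integers, and absolute
    convergence turns the series over n into such a sum.\<close>
  have "summable (\<lambda>n. norm (T n))"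
  proof (rule summable_comparison_test')
    show "summable (\<lambda>n. inverse ((real (Suc n))\<^sup>2))"
      using inverse_power_summable[of 2, where ?'a = real] by (subst summable_Suc_iff) simp
    fix n
    have "norm (T n) \<le> (1 / (real (Suc n))\<^sup>2 + 1 / (real (Suc n))\<^sup>2) / (4 * pi\<^sup>2)"
      unfolding T norm_divide
      by (intro frac_le norm_triangle_le_diff add_mono)
         (auto simp: norm_divide norm_power norm_mult simp del: of_nat_Suc)
    also have "\<dots> = inverse ((real (Suc n))\<^sup>2) * (1 / (2 * pi\<^sup>2))" by (simp add: field_simps)
    also have "\<dots> \<le> inverse ((real (Suc n))\<^sup>2) * 1"
    proof (intro mult_left_mono)
      have "2\<^sup>2 \<le> pi\<^sup>2" by (intro power_mono pi_ge_two) auto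
      then show "1 / (2 * pi\<^sup>2) \<le> 1" by simp
    qed simp
    finally show "norm (norm (T n)) \<le> inverse ((real (Suc n))\<^sup>2)" by simp
  qed
  from norm_summable_imp_has_sum[OF this sums]
  have hs: "(T has_sum ((gauss_series 0 - gauss_series x) / of_real (4 * pi\<^sup>2))) UNIV" .
  define P where "P = range (\<lambda>n. int (Suc n))"
  define M where "M = range (\<lambda>n. - int (Suc n))"
  have "inj (\<lambda>n. int (Suc n))" "inj (\<lambda>n. - int (Suc n))" by (auto simp: inj_def)
  note inj = this
  have p: "((\<lambda>k. phi_term k t) has_sum ((gauss_series 0 - gauss_series x) / of_real (4 * pi\<^sup>2))) P"
    unfolding P_def using hs by (subst has_sum_reindex[OF inj(1)]) (simp add: o_def T_def[abs_def])
  have m: "((\<lambda>k. phi_term k t) has_sum ((gauss_series 0 - gauss_series x) / of_real (4 * pi\<^sup>2))) M"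
  proof -
    have "phi_term (- int (Suc n)) t = T n" for n
      by (simp only: T_def phi_term_def power2_minus neg_equal_0_iff_equal)
    then show ?thesis unfolding M_def using hs by (subst has_sum_reindex[OF inj(2)]) (simp add: o_def)
  qed
  have z: "((\<lambda>k. phi_term k t) has_sum (\<i> * of_real t)) {0}"
    using has_sum_finite[of "{0}" "\<lambda>k. phi_term k t"] by (simp add: phi_term_def)
  have cover: "(UNIV :: int set) = {0} \<union> (P \<union> M)"
  proof -
    have "k \<in> {0} \<union> (P \<union> M)" for k
    proof (cases k)
      case (nonneg n)
      then show ?thesis by (cases n) (auto simp: P_def)
    next
      case (neg n)
      then show ?thesis unfolding M_def by blast
    qed
    then show ?thesis by blast
  qed
  have "((\<lambda>k. phi_term k t) has_sum (\<i> * of_real t + ((gauss_series 0 - gauss_series x) / of_real (4 * pi\<^sup>2)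
      + (gauss_series 0 - gauss_series x) / of_real (4 * pi\<^sup>2)))) ({0} \<union> (P \<union> M))"
    by (intro has_sum_Un_disjoint z p m) (auto simp: P_def M_def)
  then have "phi t = \<i> * of_real t + ((gauss_series 0 - gauss_series x) / of_real (4 * pi\<^sup>2)
      + (gauss_series 0 - gauss_series x) / of_real (4 * pi\<^sup>2))"
    unfolding phi_def cover by (rule infsumI)
  moreover have "z / of_real (4 * pi\<^sup>2) + z / of_real (4 * pi\<^sup>2) = z / of_real (2 * pi\<^sup>2)" for z :: complex
    by (simp add: field_simps)
  ultimately show ?thesis by (simp only: x_def)
qed

lemma norm_phi_diff_le:
  "norm (phi t - phi u) \<le> \<bar>t - u\<bar> + norm (gauss_series (- 2 * pi * t) - gauss_series (- 2 * pi * u))"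
proof -
  define G where "G = gauss_series (- 2 * pi * t) - gauss_series (- 2 * pi * u)"
  have "phi t - phi u = \<i> * of_real (t - u) - G / of_real (2 * pi\<^sup>2)"
    unfolding phi_eq_gauss_series G_def by (simp add: field_simps)
  also have "norm \<dots> \<le> norm (\<i> * complex_of_real (t - u)) + norm (G / of_real (2 * pi\<^sup>2))"
    by (rule norm_triangle_ineq4)
  also have "norm (\<i> * complex_of_real (t - u)) = \<bar>t - u\<bar>" by (simp add: norm_mult del: of_real_diff)
  also have "norm (G / of_real (2 * pi\<^sup>2)) \<le> norm G"
  proof -
    have "2\<^sup>2 \<le> pi\<^sup>2" by (intro power_mono pi_ge_two) auto
    then have "norm G / (2 * pi\<^sup>2) \<le> norm G / 1" by (intro divide_left_mono) auto
    then show ?thesis by (simp add: norm_divide norm_mult norm_power)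
  qed
  finally show ?thesis by (simp add: G_def)
qed

section \<open>Images of well approximable points\<close>

text \<open>The limsup set of the Jarnik-Besicovitch theorem. By coprimality no rational belongs to
  it when \<mu> > 1, so rational points are treated apart.\<close>

definition well_approximable :: "real \<Rightarrow> real set" where
  "well_approximable \<mu> = {x. \<forall>Q. \<exists>q>Q. \<exists>p. coprime p (int q) \<and> \<bar>x - of_int p / real q\<bar> \<le> real q powr (-\<mu>)}"

text \<open>Both points are compared with the centre p/q. As \<mu> >= 2 gives |h| <= q^(-2), the
  increment is of order q^(-1/2) |h|^((1-e)/2), and |h| <= q^(-\<mu>) produces the exponent. The
  affine part of \<open>phi\<close> contributes at most q^(-\<mu>), which is no larger since \<mu>
  >= (1 + \<mu>(1-e))/2.\<close>

lemma phi_image_near_rational: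
  fixes e \<mu> :: real
  assumes e: "0 < e" "e < 1" and \<mu>: "2 \<le> \<mu>"
  obtains B where "0 \<le> B" "\<And>p q t u. coprime p (int q) \<Longrightarrow> 0 < q \<Longrightarrow>
      \<bar>- 2 * pi * t - of_int p / real q\<bar> \<le> real q powr (-\<mu>) \<Longrightarrow>
      \<bar>- 2 * pi * u - of_int p / real q\<bar> \<le> real q powr (-\<mu>) \<Longrightarrow>
      norm (phi t - phi u) \<le> B * real q powr (- (1 + \<mu> * (1 - e)) / 2)"
proof -
  define C where "C = (30 / (1 - e)) * sqrt (145 * (1 + 1 / (2 * e)) * 3)"
  have C: "0 \<le> C" using e by (simp add: C_def)
  have centre: "norm (phi t - phi (- (of_int p / real q) / (2 * pi))) \<le> (1 + C) * real q powr (- (1 + \<mu> * (1 - e)) / 2)"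
    if cop: "coprime p (int q)" and q: "0 < q"
      and t: "\<bar>- 2 * pi * t - of_int p / real q\<bar> \<le> real q powr (-\<mu>)" for p q t
  proof -
    define h where "h = - 2 * pi * t - of_int p / real q"
    define u where "u = - (of_int p / real q) / (2 * pi)"
    have u: "- 2 * pi * u = of_int p / real q" "- 2 * pi * t = of_int p / real q + h"
      by (auto simp: u_def h_def)
    have "t - u = - h / (2 * pi)" by (simp add: h_def u_def field_simps)
    then have "\<bar>t - u\<bar> = \<bar>h\<bar> / (2 * pi)" by (simp add: abs_divide)
    also have "\<dots> \<le> \<bar>h\<bar> / 1" using pi_ge_two by (intro divide_left_mono) auto
    also have "\<dots> \<le> real q powr (-\<mu>)" using t by (simp add: h_def)
    also have "\<dots> \<le> real q powr (- (1 + \<mu> * (1 - e)) / 2)"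
    proof (intro powr_mono)
      have "0 \<le> \<mu> * e" using \<mu> e by auto
      then show "- \<mu> \<le> - (1 + \<mu> * (1 - e)) / 2" using \<mu> by (simp add: algebra_simps)
    qed (use q in auto)
    finally have 1: "\<bar>t - u\<bar> \<le> real q powr (- (1 + \<mu> * (1 - e)) / 2)" .
    have 2: "norm (gauss_series (of_int p / real q + h) - gauss_series (of_int p / real q))
        \<le> C * real q powr (- (1 + \<mu> * (1 - e)) / 2)"
    proof (cases "h = 0")
      case False
      have "real q powr (-\<mu>) \<le> real q powr (-2)" using \<mu> q by (intro powr_mono) auto
      also have "\<dots> = 1 / (real q)\<^sup>2" using q by (simp add: powr_minus_divide)
      finally have hq: "\<bar>h\<bar> \<le> 1 / (real q)\<^sup>2" using t by (simp add: h_def)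
      have "norm (gauss_series (of_int p / real q + h) - gauss_series (of_int p / real q))
          \<le> (30 / (1 - e)) * sqrt (145 * (1 + 1 / (2 * e)) * (3 / real q)) * \<bar>h\<bar> powr ((1 - e) / 2)"
        by (rule gauss_series_near_rational[OF e cop q False hq])
      also have "sqrt (145 * (1 + 1 / (2 * e)) * (3 / real q)) = sqrt (145 * (1 + 1 / (2 * e)) * 3) * real q powr (-1/2)"
      proof -
        have "145 * (1 + 1 / (2 * e)) * (3 / real q) = (145 * (1 + 1 / (2 * e)) * 3) * (1 / real q)" by simp
        moreover have "sqrt (1 / real q) = real q powr (-1/2)"
          using q by (simp add: powr_minus_divide powr_half_sqrt real_sqrt_divide)
        ultimately show ?thesis by (simp only: real_sqrt_mult)
      qed
      also have "(30 / (1 - e)) * (sqrt (145 * (1 + 1 / (2 * e)) * 3) * real q powr (-1/2)) * \<bar>h\<bar> powr ((1 - e) / 2)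
          \<le> (30 / (1 - e)) * (sqrt (145 * (1 + 1 / (2 * e)) * 3) * real q powr (-1/2)) * (real q powr (-\<mu>)) powr ((1 - e) / 2)"
        using t e by (intro mult_left_mono powr_mono2) (auto simp: h_def)
      also have "\<dots> = C * (real q powr (-1/2) * real q powr (- \<mu> * ((1 - e) / 2)))"
        by (simp add: C_def powr_powr)
      also have "real q powr (-1/2) * real q powr (- \<mu> * ((1 - e) / 2)) = real q powr (- (1 + \<mu> * (1 - e)) / 2)"
        unfolding powr_add[symmetric] by (intro arg_cong[of _ _ "\<lambda>t. real q powr t"]) (simp add: field_simps)
      finally show ?thesis .
    qed (use C in simp)
    show ?thesis using norm_phi_diff_le[of t u] 1 2 unfolding u
      by (simp add: algebra_simps u_def)
  qed
  show ?thesis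
  proof (rule that[of "2 * (1 + C)"])
    fix p q t u
    assume a: "coprime p (int q)" "0 < q"
      "\<bar>- 2 * pi * t - of_int p / real q\<bar> \<le> real q powr (-\<mu>)"
      "\<bar>- 2 * pi * u - of_int p / real q\<bar> \<le> real q powr (-\<mu>)"
    define v where "v = - (of_int p / real q) / (2 * pi)"
    have "norm (phi t - phi u) = norm ((phi t - phi v) - (phi u - phi v))" by simp
    also have "\<dots> \<le> norm (phi t - phi v) + norm (phi u - phi v)" by (rule norm_triangle_ineq4)
    also have "\<dots> \<le> 2 * ((1 + C) * real q powr (- (1 + \<mu> * (1 - e)) / 2))"
      using centre[OF a(1-3)] centre[OF a(1,2,4)] unfolding v_def by linarith
    finally show "norm (phi t - phi u) \<le> 2 * (1 + C) * real q powr (- (1 + \<mu> * (1 - e)) / 2)"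
      by (simp only: mult.assoc)
  qed (use C in simp)
qed

text \<open>In a bounded range O(q) fractions have denominator q, each contributing
  q^(-s(1+\<mu>(1-e))/2); the last hypothesis says exactly that the total exponent is below -1. The
  sets \<open>F n\<close> exhaust the line by bounded ranges.\<close>

lemma hausdorff_content_phi_well_approximable:
  fixes s \<mu> e :: real
  assumes s: "0 < s" and e: "0 < e" "e < 1" and \<mu>: "2 \<le> \<mu>" and se: "4 < s * (1 + \<mu> * (1 - e))"
  shows "hausdorff_content s (phi ` {t. - 2 * pi * t \<in> well_approximable \<mu>}) = 0"
proof -
  define \<kappa> where "\<kappa> = - (1 + \<mu> * (1 - e)) / 2"
  obtain B where B: "0 \<le> B" "\<And>p q t u. coprime p (int q) \<Longrightarrow> 0 < q \<Longrightarrow>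
      \<bar>- 2 * pi * t - of_int p / real q\<bar> \<le> real q powr (-\<mu>) \<Longrightarrow>
      \<bar>- 2 * pi * u - of_int p / real q\<bar> \<le> real q powr (-\<mu>) \<Longrightarrow>
      norm (phi t - phi u) \<le> B * real q powr \<kappa>"
    using phi_image_near_rational[OF e \<mu>] unfolding \<kappa>_def by metis
  define F where "F n = {t. - 2 * pi * t \<in> well_approximable \<mu> \<and> \<bar>- 2 * pi * t\<bar> \<le> real n}" for n
  \<comment> \<open>The numerator is p = i - (n+1) q, so that natural numbers \<open>i\<close> index
    all |p| <= (n+1) q; n + 1 in place of n leaves room for the approximation error, which is at
    most 1.\<close>
  define V where "V n q i = (if coprime (int i - int (Suc n * q)) (int q)
      then phi ` {t. \<bar>- 2 * pi * t - of_int (int i - int (Suc n * q)) / real q\<bar> \<le> real q powr (-\<mu>)} else {})" for n q i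
  have "hausdorff_content s (phi ` F n) = 0" for n
  proof (rule hausdorff_content_limsup_eq_0[OF s, where V = "V n" and D = "\<lambda>q. B * real q powr \<kappa>" and N = "\<lambda>q. 2 * Suc n * q + 1"])
    have dist: "norm (a - b) \<le> B * real q powr \<kappa>" if "0 < q" "a \<in> V n q i" "b \<in> V n q i" for q i a b
      using that unfolding V_def by (auto split: if_splits intro!: B(2))
    show "bounded (V n q i)" if "0 < q" for q i
      unfolding bounded_two_points dist_norm using dist[OF that] by blast
    show "diameter (V n q i) \<le> B * real q powr \<kappa>" if "0 < q" for q i
      using dist[OF that] B(1) by (intro diameter_le) auto
    show "summable (\<lambda>q. real (2 * Suc n * q + 1) * (B * real q powr \<kappa>) powr s)"
    proof (rule summable_comparison_test')
      have "1 + \<kappa> * s < -1" using se by (simp add: \<kappa>_def field_simps)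
      then show "summable (\<lambda>q. (real (2 * Suc n + 1) * B powr s) * real q powr (1 + \<kappa> * s))"
        by (intro summable_mult) (simp add: summable_real_powr_iff)
      fix q :: nat assume q: "1 \<le> q"
      have "real (2 * Suc n * q + 1) \<le> real ((2 * Suc n + 1) * q)" using q by (subst of_nat_le_iff) simp
      then have "real (2 * Suc n * q + 1) * (B powr s * real q powr (\<kappa> * s))
          \<le> real ((2 * Suc n + 1) * q) * (B powr s * real q powr (\<kappa> * s))"
        by (intro mult_right_mono) auto
      also have "\<dots> = (real (2 * Suc n + 1) * B powr s) * real q powr (1 + \<kappa> * s)"
        using q by (simp add: powr_add algebra_simps)
      finally show "norm (real (2 * Suc n * q + 1) * (B * real q powr \<kappa>) powr s)
          \<le> (real (2 * Suc n + 1) * B powr s) * real q powr (1 + \<kappa> * s)"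
        by (simp add: powr_mult powr_powr)
    qed
    show "phi ` F n \<subseteq> (\<Union>q\<in>{Q<..}. \<Union>i<2 * Suc n * q + 1. V n q i)" for Q
    proof
      fix a assume "a \<in> phi ` F n"
      then obtain t where t: "a = phi t" "- 2 * pi * t \<in> well_approximable \<mu>" "\<bar>- 2 * pi * t\<bar> \<le> real n"
        by (auto simp: F_def)
      then obtain q p where pq: "Q < q" "coprime p (int q)" "\<bar>- 2 * pi * t - of_int p / real q\<bar> \<le> real q powr (-\<mu>)"
        unfolding well_approximable_def by blast
      have "real q powr (-\<mu>) \<le> real q powr 0" using pq(1) \<mu> by (intro powr_mono) auto
      then have "\<bar>of_int p / real q\<bar> \<le> real (Suc n)" using pq(1,3) t(3) by simp
      then have "\<bar>of_int p\<bar> \<le> real (Suc n * q)" using pq(1) by (simp add: abs_divide field_simps)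
      then have "\<bar>p\<bar> \<le> int (Suc n * q)" by linarith
      then have i: "p = int (nat (p + int (Suc n * q))) - int (Suc n * q)" "nat (p + int (Suc n * q)) < 2 * Suc n * q + 1"
        unfolding mult.assoc[of 2] by linarith+
      have "a \<in> V n q (nat (p + int (Suc n * q)))"
        unfolding V_def i(1)[symmetric] using pq t(1) by auto
      then show "a \<in> (\<Union>q\<in>{Q<..}. \<Union>i<2 * Suc n * q + 1. V n q i)" using pq(1) i(2) by blast
    qed
  qed
  then have "hausdorff_content s (\<Union>n. phi ` F n) = 0" by (rule hausdorff_content_countable_Union_eq_0)
  moreover have "phi ` {t. - 2 * pi * t \<in> well_approximable \<mu>} \<subseteq> (\<Union>n. phi ` F n)"
    using real_arch_simple unfolding F_def by blast
  ultimately show ?thesis using hausdorff_content_mono by (metis le_zero_eq)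
qed

section \<open>Pointwise Hoelder regularity outside the well approximable set\<close>

text \<open>For each q the number q x has positive distance to the integers, and finitely many q
  have a positive minimum. This covers the small denominators, about which the failure of
  \<open>well_approximable\<close> says nothing.\<close>

lemma irrational_distance_bound:
  fixes x :: real
  assumes "x \<notin> \<rat>"
  shows "\<exists>c>0. \<forall>q p. 0 < q \<longrightarrow> q \<le> Q \<longrightarrow> c \<le> \<bar>x - of_int p / real q\<bar>"
proof (induction Q)
  case 0
  then show ?case by (intro exI[of _ 1]) auto
next
  case (Suc Q)
  then obtain c where c: "0 < c" "\<And>q p. 0 < q \<Longrightarrow> q \<le> Q \<Longrightarrow> c \<le> \<bar>x - of_int p / real q\<bar>" by auto
  define y where "y = real (Suc Q) * x"
  have "y \<notin> \<int>"
  proof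
    assume "y \<in> \<int>"
    then have "y / real (Suc Q) \<in> \<rat>" by (intro Rats_divide) (auto simp: Ints_def)
    then show False using assms by (simp add: y_def)
  qed
  then have fr: "0 < frac y" "frac y < 1" by (auto simp: frac_gt_0_iff frac_lt_1)
  define d where "d = min (frac y) (1 - frac y) / real (Suc Q)"
  have d: "0 < d" using fr by (simp add: d_def)
  have dp: "d \<le> \<bar>x - of_int p / real (Suc Q)\<bar>" for p
  proof -
    have "min (frac y) (1 - frac y) \<le> \<bar>y - of_int p\<bar>"
    proof (cases "p \<le> \<lfloor>y\<rfloor>")
      case True
      then have "real_of_int p \<le> of_int \<lfloor>y\<rfloor>" by simp
      then show ?thesis by (simp add: frac_def)
    next
      case False
      then have "\<lfloor>y\<rfloor> + 1 \<le> p" by simp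
      then have "real_of_int (\<lfloor>y\<rfloor> + 1) \<le> of_int p" by (simp only: of_int_le_iff)
      then show ?thesis by (simp add: frac_def)
    qed
    then have "d \<le> \<bar>y - of_int p\<bar> / real (Suc Q)" unfolding d_def by (intro divide_right_mono) auto
    also have "\<dots> = \<bar>(y - of_int p) / real (Suc Q)\<bar>" by (simp add: abs_divide)
    also have "(y - of_int p) / real (Suc Q) = x - of_int p / real (Suc Q)"
      by (simp add: y_def diff_divide_distrib del: of_nat_Suc)
    finally show ?thesis .
  qed
  show ?case
  proof (intro exI[of _ "min c d"] conjI allI impI)
    fix q p assume "0 < q" "q \<le> Suc Q"
    then show "min c d \<le> \<bar>x - of_int p / real q\<bar>"
      using c(2)[of q p] dp[of p] by (cases "q = Suc Q") auto
  qed (use c d in auto)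
qed

text \<open>This serves \<alpha> = 3/4, where the strict inequality in
  \<open>low_holder_exponent_well_approximable\<close> would require \<mu> < 2.\<close>

lemma irrational_well_approximable_2:
  assumes "x \<notin> \<rat>"
  shows "x \<in> well_approximable 2"
  unfolding well_approximable_def
proof (intro CollectI allI)
  fix Q :: nat
  have "infinite (approx_set x)" using assms rational_iff_finite_approx_set by blast
  then obtain p q' where pq: "(p, q') \<in> approx_set x" "int Q < q'"
    using infinite_approx_set by blast
  define q where "q = nat q'"
  have q: "q' = int q" "Q < q" using pq(2) by (auto simp: q_def)
  have "coprime p (int q)" "\<bar>x - of_int p / real q\<bar> < 1 / (real q)\<^sup>2"
    using pq(1) q by (auto simp: approx_set_def)
  moreover have "1 / (real q)\<^sup>2 = real q powr (-2)" using q by (simp add: powr_minus_divide)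
  ultimately show "\<exists>q>Q. \<exists>p. coprime p (int q) \<and> \<bar>x - of_int p / real q\<bar> \<le> real q powr (- 2)"
    using q(2) by (intro exI[of _ q] conjI exI[of _ p]) auto
qed

text \<open>Since 0 < \<beta> <= 1, a constant polynomial serves, and the affine part of
  \<open>phi\<close> is absorbed by |h| <= |h|^\<beta> for small h.\<close>

lemma pointwise_holder_phi:
  fixes t \<mu> e :: real
  assumes e: "0 < e" "e < 1" and \<mu>: "2 \<le> \<mu>"
    and x: "- 2 * pi * t \<notin> \<rat>" "- 2 * pi * t \<notin> well_approximable \<mu>"
    and \<beta>: "\<beta> = 1/2 + 1 / (2 * \<mu>) - e / 2"
  shows "pointwise_holder \<beta> phi t"
proof -
  define x where "x = - 2 * pi * t"
  obtain Q where Q: "\<And>p q. Q < q \<Longrightarrow> coprime p (int q) \<Longrightarrow> real q powr (-\<mu>) < \<bar>x - of_int p / real q\<bar>"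
    using x(2) unfolding well_approximable_def x_def[symmetric] by (auto simp: not_le)
  obtain c where c: "0 < c" "\<And>q p. 0 < q \<Longrightarrow> q \<le> Q \<Longrightarrow> c \<le> \<bar>x - of_int p / real q\<bar>"
    using irrational_distance_bound[OF x(1)] unfolding x_def by metis
  \<comment> \<open>One constant for all denominators: the factor 1 works for q > Q, and
    \<open>c\<close> works for q <= Q because q^(-\<mu>) <= 1.\<close>
  define d where "d = min 1 c"
  have d: "0 < d" "d \<le> 1" "d \<le> c" using c by (auto simp: d_def)
  have bad: "d * real q powr (-\<mu>) \<le> \<bar>x - of_int p / real q\<bar>" if "coprime p (int q)" "0 < q" for p q
  proof (cases "Q < q")
    case True
    have "d * real q powr (-\<mu>) \<le> 1 * real q powr (-\<mu>)" using d by (intro mult_right_mono) auto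
    then show ?thesis using Q[OF True that(1)] by simp
  next
    case False
    have "real q powr (-\<mu>) \<le> real q powr 0" using that \<mu> by (intro powr_mono) auto
    then have "d * real q powr (-\<mu>) \<le> c * 1" using d that by (intro mult_mono) auto
    then show ?thesis using c(2)[of q p] that False by simp
  qed
  define C where "C = (30 / (1 - e)) * sqrt (145 * (1 + 1 / (2 * e)) * (8 + (2 / d) powr (1 / \<mu>) + 8 / d))"
  have C: "0 \<le> C" using e d by (simp add: C_def)
  have "1 / (2 * \<mu>) \<le> 1 / 4" "0 < 1 / (2 * \<mu>)" using \<mu> by (auto simp: field_simps)
  then have \<beta>1: "0 < \<beta>" "\<beta> \<le> 1" using e unfolding \<beta> by linarith+
  have bound: "norm (phi (t + h) - poly [:phi t:] (complex_of_real h)) \<le> (1 + C * (2 * pi) powr \<beta>) * abs_pow h \<beta>"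
    if h: "\<bar>h\<bar> \<le> 1 / (2 * pi)" for h
  proof (cases "h = 0")
    case False
    have "1 / (2 * pi) \<le> 1" using pi_ge_two by simp
    with h have h1: "\<bar>h\<bar> \<le> 1" by linarith
    have "norm (gauss_series (x + - 2 * pi * h) - gauss_series x) \<le> C * \<bar>- 2 * pi * h\<bar> powr (1/2 + 1 / (2 * \<mu>) - e / 2)"
      unfolding C_def
      by (rule gauss_series_badly_approximable[OF e \<mu> d(1) bad]) (use False h in \<open>auto simp: abs_mult field_simps\<close>)
    also have "\<bar>- 2 * pi * h\<bar> = 2 * pi * \<bar>h\<bar>" by (simp add: abs_mult)
    also have "(2 * pi * \<bar>h\<bar>) powr (1/2 + 1 / (2 * \<mu>) - e / 2) = (2 * pi) powr \<beta> * \<bar>h\<bar> powr \<beta>"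
      unfolding \<beta> by (simp only: powr_mult)
    finally have g: "norm (gauss_series (x + - 2 * pi * h) - gauss_series x) \<le> C * ((2 * pi) powr \<beta> * \<bar>h\<bar> powr \<beta>)" .
    have "\<bar>h\<bar> powr 1 \<le> \<bar>h\<bar> powr \<beta>" using h1 \<beta>1 False by (intro powr_mono') auto
    then have hb: "\<bar>h\<bar> \<le> \<bar>h\<bar> powr \<beta>" using False by simp
    have "- 2 * pi * (t + h) = x + - 2 * pi * h" by (simp add: x_def algebra_simps)
    then have "norm (phi (t + h) - phi t) \<le> \<bar>h\<bar> + norm (gauss_series (x + - 2 * pi * h) - gauss_series x)"
      using norm_phi_diff_le[of "t + h" t] by (simp add: x_def)
    also have "\<dots> \<le> \<bar>h\<bar> powr \<beta> + C * ((2 * pi) powr \<beta> * \<bar>h\<bar> powr \<beta>)" using hb g by (rule add_mono)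
    finally show ?thesis using \<beta>1 by (simp add: abs_pow_def algebra_simps)
  qed (use C in \<open>simp add: abs_pow_def\<close>)
  have "\<forall>\<^sub>F h in nhds 0. \<bar>h\<bar> < 1 / (2 * pi)"
    unfolding eventually_nhds_metric by (intro exI[of _ "1 / (2 * pi)"]) (auto simp: dist_real_def)
  then have "\<forall>\<^sub>F h in nhds 0. norm (phi (t + h) - poly [:phi t:] (complex_of_real h)) \<le> (1 + C * (2 * pi) powr \<beta>) * abs_pow h \<beta>"
    by eventually_elim (intro bound, simp)
  moreover have "0 < 1 + C * (2 * pi) powr \<beta>" using C by (simp add: add_pos_nonneg)
  moreover have "real (degree [:phi t:]) \<le> \<beta>" using \<beta>1 by simp
  ultimately show ?thesis unfolding pointwise_holder_def by blast
qed

lemma low_holder_exponent_well_approximable: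
  fixes t \<mu> \<alpha> :: real
  assumes \<mu>: "2 \<le> \<mu>" and \<alpha>: "\<alpha> < 1/2 + 1 / (2 * \<mu>)"
    and x: "- 2 * pi * t \<notin> \<rat>" and t: "holder_exponent phi t \<le> ereal \<alpha>"
  shows "- 2 * pi * t \<in> well_approximable \<mu>"
proof (rule ccontr)
  assume n: "- 2 * pi * t \<notin> well_approximable \<mu>"
  \<comment> \<open>Only half of the margin is spent, so \<beta> stays strictly above \<alpha>; the
    cap 1/2 keeps e < 1.\<close>
  define e where "e = min (1/2) (1/2 + 1 / (2 * \<mu>) - \<alpha>)"
  define \<beta> where "\<beta> = 1/2 + 1 / (2 * \<mu>) - e / 2"
  have e: "0 < e" "e < 1" using \<alpha> by (auto simp: e_def)
  have ba: "\<alpha> < \<beta>"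
  proof -
    have "e \<le> 1/2 + 1 / (2 * \<mu>) - \<alpha>" by (simp add: e_def)
    then show ?thesis using e(1) unfolding \<beta>_def by linarith
  qed
  have "0 \<le> 1 / (2 * \<mu>)" using \<mu> by simp
  then have "0 \<le> \<beta>" using e unfolding \<beta>_def by linarith
  moreover have "pointwise_holder \<beta> phi t" by (rule pointwise_holder_phi[OF e \<mu> x n \<beta>_def])
  ultimately have "ereal \<beta> \<le> holder_exponent phi t"
    unfolding holder_exponent_def by (intro Sup_upper) auto
  with t ba show False by (metis ereal_less_eq(3) order_trans not_le)
qed

section \<open>The dimension bound\<close>

theorem theorem1p2:
  fixes \<alpha> :: real
  assumes "1/2 \<le> \<alpha>" and "\<alpha> \<le> 3/4"
  defines "D \<equiv> (\<lambda>\<sigma>::real. {x::real. holder_exponent phi x = ereal \<sigma>})"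
  shows "hausdorff_dim (phi ` D \<alpha>)
           \<le> hausdorff_dim (phi ` (\<Union>\<sigma>\<in>{\<sigma>. 0 \<le> \<sigma> \<and> \<sigma> \<le> \<alpha>}. D \<sigma>))
       \<and> hausdorff_dim (phi ` (\<Union>\<sigma>\<in>{\<sigma>. 0 \<le> \<sigma> \<and> \<sigma> \<le> \<alpha>}. D \<sigma>))
           \<le> ereal ((4 * \<alpha> - 2) / \<alpha>)"
proof (intro conjI)
  define G where "G = (\<Union>\<sigma>\<in>{\<sigma>. 0 \<le> \<sigma> \<and> \<sigma> \<le> \<alpha>}. D \<sigma>)"
  show "hausdorff_dim (phi ` D \<alpha>) \<le> hausdorff_dim (phi ` (\<Union>\<sigma>\<in>{\<sigma>. 0 \<le> \<sigma> \<and> \<sigma> \<le> \<alpha>}. D \<sigma>))"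
    using assms(1) by (intro hausdorff_dim_mono image_mono UN_upper) auto
  have "hausdorff_content s (phi ` G) = 0" if s: "(4 * \<alpha> - 2) / \<alpha> < s" for s
  proof -
    have "0 \<le> (4 * \<alpha> - 2) / \<alpha>" using assms(1) by (intro divide_nonneg_nonneg) auto
    then have s0: "0 < s" using s by simp
    have s\<alpha>: "4 * \<alpha> - 2 < s * \<alpha>" using s assms(1) by (simp add: divide_less_eq)
    \<comment> \<open>The first bound makes the covers of the image summable, the second puts the
      regularity threshold 1/2 + 1/(2\<mu>) above \<alpha>. They are compatible because \<mu> =
      1/(2\<alpha> - 1) has 4/(1+\<mu>) = (4\<alpha> - 2)/\<alpha> < s. At \<alpha> = 1/2 there is
      no upper limit on \<mu>; at \<alpha> = 3/4 the critical value is 2 itself, and Dirichlet's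
      theorem takes over.\<close>
    obtain \<mu> where \<mu>: "2 \<le> \<mu>" "4 < s * (1 + \<mu>)" "\<mu> = 2 \<or> \<mu> * (2 * \<alpha> - 1) < 1"
    proof (cases "\<alpha> = 3/4")
      case True
      have "4 < s * 3" using s\<alpha> by (simp add: True)
      then show ?thesis by (intro that[of 2]) auto
    next
      case False
      have "\<exists>\<mu>. max 2 (4 / s - 1) < \<mu> \<and> \<mu> * (2 * \<alpha> - 1) < 1"
      proof (cases "\<alpha> = 1/2")
        case True
        have "max 2 (4 / s - 1) < max 2 (4 / s - 1) + 1" by simp
        then show ?thesis unfolding True by (intro exI[of _ "max 2 (4 / s - 1) + 1"] conjI) auto
      next
        case a: False
        then have a: "0 < 2 * \<alpha> - 1" using assms(1) by simp
        have "4 < s * (1 + 1 / (2 * \<alpha> - 1))" using s\<alpha> a by (simp add: field_simps)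
        then have "4 / s - 1 < 1 / (2 * \<alpha> - 1)" using s0 by (simp add: field_simps)
        moreover have "2 < 1 / (2 * \<alpha> - 1)" using a False assms(2) by (simp add: field_simps)
        ultimately obtain \<mu> where "max 2 (4 / s - 1) < \<mu>" "\<mu> < 1 / (2 * \<alpha> - 1)"
          using dense[of "max 2 (4 / s - 1)" "1 / (2 * \<alpha> - 1)"] by auto
        then show ?thesis using a by (auto simp: field_simps intro!: exI[of _ \<mu>])
      qed
      then obtain \<mu> where "max 2 (4 / s - 1) < \<mu>" "\<mu> * (2 * \<alpha> - 1) < 1" by auto
      then show ?thesis using s0 by (intro that[of \<mu>]) (auto simp: field_simps)
    qed
    \<comment> \<open>With this choice e s \<mu> uses up at most half of the surplus s(1+\<mu>) - 4,
      so the strict inequality survives the loss.\<close>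
    define e where "e = min (1/2) ((s * (1 + \<mu>) - 4) / (2 * s * \<mu>))"
    have sm: "0 < s * \<mu>" using s0 \<mu> by simp
    have e: "0 < e" "e < 1" using \<mu> s0 by (auto simp: e_def)
    have "e \<le> (s * (1 + \<mu>) - 4) / (2 * s * \<mu>)" by (simp add: e_def)
    then have "2 * (e * (s * \<mu>)) \<le> s * (1 + \<mu>) - 4" using sm by (simp add: field_simps)
    moreover have "0 < e * (s * \<mu>)" using e sm by simp
    ultimately have "4 < s * (1 + \<mu>) - e * (s * \<mu>)" by linarith
    then have se: "4 < s * (1 + \<mu> * (1 - e))" by (simp add: algebra_simps)
    have sub: "G \<subseteq> {t. - 2 * pi * t \<in> \<rat>} \<union> {t. - 2 * pi * t \<in> well_approximable \<mu>}"
    proof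
      fix t assume "t \<in> G"
      then have t: "holder_exponent phi t \<le> ereal \<alpha>" by (auto simp: G_def D_def)
      have "- 2 * pi * t \<in> well_approximable \<mu>" if "- 2 * pi * t \<notin> \<rat>"
        using \<mu>(3)
      proof
        assume "\<mu> = 2"
        then show ?thesis using irrational_well_approximable_2[OF that] by simp
      next
        assume "\<mu> * (2 * \<alpha> - 1) < 1"
        then have "\<alpha> < 1/2 + 1 / (2 * \<mu>)" using \<mu>(1) by (simp add: field_simps)
        then show ?thesis by (rule low_holder_exponent_well_approximable[OF \<mu>(1) _ that t])
      qed
      then show "t \<in> {t. - 2 * pi * t \<in> \<rat>} \<union> {t. - 2 * pi * t \<in> well_approximable \<mu>}" by blast
    qed
    have "{t. - 2 * pi * t \<in> \<rat>} \<subseteq> (\<lambda>r. r / (- 2 * pi)) ` \<rat>"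
    proof
      fix t assume "t \<in> {t. - 2 * pi * t \<in> \<rat>}"
      then show "t \<in> (\<lambda>r. r / (- 2 * pi)) ` \<rat>" by (intro image_eqI[of _ _ "- 2 * pi * t"]) auto
    qed
    then have "countable {t. - 2 * pi * t \<in> \<rat>}"
      by (rule countable_subset) (intro countable_image countable_rat)
    then have "hausdorff_content s (phi ` {t. - 2 * pi * t \<in> \<rat>}) = 0"
      by (intro hausdorff_content_countable_eq_0 s0 countable_image)
    then have "hausdorff_content s (phi ` {t. - 2 * pi * t \<in> \<rat>} \<union> phi ` {t. - 2 * pi * t \<in> well_approximable \<mu>}) = 0"
      by (intro hausdorff_content_Un_eq_0 hausdorff_content_phi_well_approximable[OF s0 e \<mu>(1) se])
    moreover have "phi ` G \<subseteq> phi ` {t. - 2 * pi * t \<in> \<rat>} \<union> phi ` {t. - 2 * pi * t \<in> well_approximable \<mu>}"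
      using sub by blast
    ultimately show ?thesis using hausdorff_content_mono by (metis le_zero_eq)
  qed
  then show "hausdorff_dim (phi ` (\<Union>\<sigma>\<in>{\<sigma>. 0 \<le> \<sigma> \<and> \<sigma> \<le> \<alpha>}. D \<sigma>)) \<le> ereal ((4 * \<alpha> - 2) / \<alpha>)"
    unfolding G_def[symmetric] using assms(1) by (intro hausdorff_dim_le divide_nonneg_nonneg) auto
qed

end
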